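(* Let $G$ be a (multiplicatively written) Polish group, let $H$ be a (multiplicatively written) separable topological group, and let $\phi : G \to H$ be a group homomorphism which is EBP-measurable. Then $\phi$ is continuous.
   Context: A Polish group is a topological group whose topology is Polish (separable and completely metrizable). Separable means having a countable dense subset. For a Polish space $X$, $\mathcal{M}(X)$ is the set of all Borel probability measures on $X$ with the coarsest topology for which each map $\mu \mapsto \int f\,d\mu$, with $f : X \to \mathbb{R}$ bounded and continuous, is continuous ($\mathcal M(X)$ is then Polish). For $A \subseteq X$, $\mathcal{N}(A) = \{\mu \in \mathcal{M}(X) : \mu^*(A) = 0\}$, where $\mu^*$ is the outer measure induced by $\mu$. $A$ is residually null if $\mathcal{N}(A)$ is co-meager in $\mathcal{M}(X)$. $A$ is an EBP-set of $X$ if there is an open set $U \subseteq X$ such that $U \triangle A$ (symmetric difference) is residually null. A function $f : X \to Y$ from a Polish space $X$ to a topological space $Y$ is EBP-measurable if $f^{-1}[U]$ is an EBP-set of $X$ for every open $U \subseteq Y$. *)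

theory Defs
  imports "HOL-Probability.Probability_Measure"
begin

text \<open>
  Groups are written additively, through the class \<^class>\<open>topological_group_add\<close>; its
  superclass \<^class>\<open>group_add\<close> does not assume commutativity, and no separation axiom is imposed.
  The complete metric that comes with \<^class>\<open>polish_space\<close> is arbitrary (not assumed invariant),
  and the definitions below use only the topology it induces.
\<close>

definition prob_measures :: "'a::polish_space measure set" where
  "prob_measures = {\<mu>. prob_space \<mu> \<and> sets \<mu> = sets borel}"

definition prob_topology :: "'a::polish_space measure topology" where
  "prob_topology = topology_generated_by
     {{\<mu> \<in> prob_measures. (\<integral>x. f x \<partial>\<mu>) \<in> V} | f V.
        continuous_on UNIV f \<and> bounded (range f) \<and> open (V :: real set)}"

text \<open>
  The next three lemmas confirm that \<^const>\<open>prob_topology\<close> is a topology on all of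
  \<^const>\<open>prob_measures\<close>, and that it is the coarsest one making integration of every bounded
  continuous function continuous.
\<close>

lemma topspace_prob_topology: "topspace prob_topology = prob_measures"
proof -
  have "prob_measures = {\<mu> \<in> prob_measures. (\<integral>x. (\<lambda>_. 0) x \<partial>\<mu>) \<in> (UNIV :: real set)}"
    by simp
  then have "\<exists>f V. (prob_measures :: 'a measure set) = {\<mu> \<in> prob_measures. (\<integral>x. f x \<partial>\<mu>) \<in> V} \<and>
      continuous_on UNIV f \<and> bounded (range f) \<and> open (V :: real set)"
    by (intro exI[of _ "\<lambda>_. 0"] exI[of _ UNIV]) auto
  then show ?thesis
    unfolding prob_topology_def topology_generated_by_topspace by blast
qed

lemma continuous_map_prob_topology_integral:
  fixes f :: "'a::polish_space \<Rightarrow> real"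
  assumes "continuous_on UNIV f" "bounded (range f)"
  shows "continuous_map prob_topology euclidean (\<lambda>\<mu>. \<integral>x. f x \<partial>\<mu>)"
  unfolding continuous_map_def topspace_prob_topology
  using assms by (auto simp: prob_topology_def intro!: topology_generated_by_Basis)

lemma prob_topology_coarsest:
  fixes T :: "'a::polish_space measure topology"
  assumes "topspace T = prob_measures"
    and "\<And>f :: 'a \<Rightarrow> real. continuous_on UNIV f \<Longrightarrow> bounded (range f) \<Longrightarrow>
           continuous_map T euclidean (\<lambda>\<mu>. \<integral>x. f x \<partial>\<mu>)"
    and "openin prob_topology W"
  shows "openin T W"
proof -
  have open_sub: "openin T {\<mu> \<in> prob_measures. (\<integral>x. f x \<partial>\<mu>) \<in> V}"
    if "continuous_on UNIV f" "bounded (range f)" "open V" for f :: "'a \<Rightarrow> real" and V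
    using assms(2)[OF that(1,2)] that(3) by (simp add: continuous_map_def assms(1))
  have "generate_topology_on
      {{\<mu> \<in> prob_measures. (\<integral>x. f x \<partial>\<mu>) \<in> V} | f V.
        continuous_on UNIV f \<and> bounded (range f) \<and> open (V :: real set)} W"
    using assms(3) unfolding prob_topology_def by (rule openin_topology_generated_by)
  then show ?thesis
    by (rule generate_topology_on_coarsest[OF istopology_openin, rotated]) (use open_sub in blast)
qed

definition nowhere_dense_in :: "'a topology \<Rightarrow> 'a set \<Rightarrow> bool" where
  "nowhere_dense_in T S \<longleftrightarrow> S \<subseteq> topspace T \<and> T interior_of (T closure_of S) = {}"

definition meager_in :: "'a topology \<Rightarrow> 'a set \<Rightarrow> bool" where
  "meager_in T S \<longleftrightarrow> (\<exists>N :: nat \<Rightarrow> 'a set. (\<forall>n. nowhere_dense_in T (N n)) \<and> S = (\<Union>n. N n))"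

definition comeager_in :: "'a topology \<Rightarrow> 'a set \<Rightarrow> bool" where
  "comeager_in T S \<longleftrightarrow> S \<subseteq> topspace T \<and> meager_in T (topspace T - S)"

definition null_measures :: "'a::polish_space set \<Rightarrow> 'a measure set" where
  "null_measures A = {\<mu> \<in> prob_measures. outer_measure_of \<mu> A = 0}"

definition residually_null :: "'a::polish_space set \<Rightarrow> bool" where
  "residually_null A \<longleftrightarrow> comeager_in prob_topology (null_measures A)"

definition EBP_set :: "'a::polish_space set \<Rightarrow> bool" where
  "EBP_set A \<longleftrightarrow> (\<exists>U. open U \<and> residually_null (sym_diff U A))"

definition EBP_measurable :: "('a::polish_space \<Rightarrow> 'b::topological_space) \<Rightarrow> bool" where
  "EBP_measurable f \<longleftrightarrow> (\<forall>U. open U \<longrightarrow> EBP_set (f -` U))"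

end

theory Submission
  imports Defs "HOL-Probability.Giry_Monad"
begin

text \<open>
  The proof is a measure-theoretic version of Pettis' argument. Let \<open>W\<close> be a neighbourhood of the
  identity of the target group, and choose a neighbourhood \<open>V\<close> of the identity with
  \<open>- a + b \<in> W\<close> for all \<open>a\<close> and \<open>b\<close> in \<open>V\<close>. By separability, countably many preimages of
  translates \<open>c + V\<close> cover the source group, and each differs from an open set by a residually null
  set. Not all of these open sets can be empty. If \<open>U\<close> is a nonempty one and \<open>A\<close> the preimage that
  belongs to it, then for all \<open>t\<close> near the identity the sets \<open>U\<close> and \<open>U - t\<close> overlap in a
  nonempty open set, so some \<open>x\<close> has both \<open>x\<close> and \<open>x + t\<close> in \<open>A\<close>. Hence
  \<open>\<phi> t = - \<phi> x + \<phi> (x + t)\<close> lies in \<open>W\<close>, and \<open>\<phi>\<close> is continuous at the identity.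

  Two steps of this argument need that a nonempty open set is never contained in a countable union
  of residually null sets (\<open>generically_null_UN\<close> and \<open>open_not_generically_null\<close>). This is the
  Baire property of the space of probability measures on a Polish space
  (\<open>prob_topology_Baire\<close>), the main work below. It is proved without metrizing that space:
  measures are represented as laws of random variables on \<open>[0, 1]\<close> with values in
  the Polish space, and the completeness of convergence in probability (\<open>limit_in_probability\<close>)
  takes the place of the completeness of a metric on measures. What links the two pictures is that
  weak closeness of laws can be realised by closeness of variables: if a measure is weakly close to
  the law of a variable with finitely many values, and finitely supported itself, then it is the law
  of a variable that is close in probability to the given one. This is
  \<open>near_diagonal_transport_plan\<close>, combined with the absence of atoms in \<open>[0, 1]\<close>, and
  leads to \<open>perturb_into_dense_open\<close>. In the other direction, \<open>law_stable\<close> says that closeness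
  in probability implies weak closeness of the laws.
\<close>

section \<open>Atomless probability spaces\<close>

text \<open>
  On such a space every finite coupling can be realised by random variables, so it can serve as
  a common source of randomness for all measures that occur.
\<close>

locale atomless_prob_space = prob_space +
  assumes split_event: "E \<in> events \<Longrightarrow> 0 \<le> s \<Longrightarrow> s \<le> prob E \<Longrightarrow> \<exists>E'\<in>events. E' \<subseteq> E \<and> prob E' = s"

text \<open>
  The function sending \<open>t\<close> to the probability of \<open>E \<inter> {..t}\<close> is 1-Lipschitz and runs from
  0 to the probability of \<open>E\<close>, so the intermediate value theorem finds a cut of the required size.
\<close>

lemma atomless_uniform: "atomless_prob_space (uniform_measure lborel {0..1::real})"
proof -
  define M where "M = uniform_measure lborel {0..1::real}"
  have prob: "prob_space M"
    unfolding M_def by (rule prob_space_uniform_measure) auto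
  interpret prob_space M by (rule prob)
  have sets_M [simp, measurable_cong]: "sets M = sets borel" by (simp add: M_def)
  have space_M [simp]: "space M = UNIV" by (simp add: M_def)
  have em: "emeasure M A = emeasure lborel ({0..1} \<inter> A)" if "A \<in> sets borel" for A
    using that by (simp add: M_def emeasure_uniform_measure divide_ennreal_def)
  have slice: "prob {u<..t} \<le> t - u" if "u \<le> t" for u t
  proof -
    have "emeasure M {u<..t} \<le> emeasure lborel {u<..t}"
      by (subst em) (auto intro!: emeasure_mono)
    also have "\<dots> = ennreal (t - u)" using that by simp
    finally show ?thesis using that by (simp add: emeasure_eq_measure)
  qed
  have "\<exists>E'\<in>events. E' \<subseteq> E \<and> prob E' = s"
    if E: "E \<in> events" and s: "0 \<le> s" "s \<le> prob E" for E s
  proof -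
    define F where "F t = prob (E \<inter> {..t})" for t
    have step: "F u \<le> F t \<and> F t \<le> F u + (t - u)" if "u \<le> t" for u t
    proof
      show "F u \<le> F t"
        unfolding F_def using E that by (intro finite_measure_mono) auto
      have "F t \<le> prob ((E \<inter> {..u}) \<union> {u<..t})"
        unfolding F_def using E by (intro finite_measure_mono) auto
      also have "\<dots> \<le> F u + prob {u<..t}"
        unfolding F_def using E by (intro measure_Un_le) auto
      finally show "F t \<le> F u + (t - u)" using slice[OF that] by simp
    qed
    have "1-lipschitz_on UNIV F"
    proof (rule lipschitz_onI)
      fix x y show "dist (F x) (F y) \<le> 1 * dist x y"
        using step[of x y] step[of y x] by (cases "x \<le> y") (auto simp: dist_real_def)
    qed simp
    then have cont: "continuous_on {0..1} F"
      using lipschitz_on_continuous_on continuous_on_subset by blast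
    have F0: "F 0 = 0"
    proof -
      have "emeasure lborel ({0..1} \<inter> (E \<inter> {..0})) \<le> emeasure lborel {0::real}"
        by (intro emeasure_mono) auto
      then have "emeasure M (E \<inter> {..0}) = 0"
        using E by (subst em) auto
      then show ?thesis by (simp add: F_def measure_def)
    qed
    have F1: "F 1 = prob E"
    proof -
      have "{0..1} \<inter> (E \<inter> {..1}) = {0..1} \<inter> E" by auto
      then have "emeasure M (E \<inter> {..1}) = emeasure M E"
        using E by (simp add: em)
      then show ?thesis by (simp add: F_def measure_def)
    qed
    obtain t where "F t = s"
      using IVT'[of F 0 s 1] F0 F1 s cont by auto
    then show ?thesis
      unfolding F_def using E by (intro bexI[of _ "E \<inter> {..t}"]) auto
  qed
  then show ?thesis
    using prob unfolding M_def[symmetric] atomless_prob_space_def atomless_prob_space_axioms_def by blast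
qed

text \<open>
  The partition is encoded as a labelling \<open>k\<close> of \<open>E\<close>, so that it can be glued over several
  events into one random variable.
\<close>

lemma (in atomless_prob_space) partition_event:
  fixes p :: "'b \<Rightarrow> real"
  assumes "finite T" "T \<noteq> {}" "E \<in> events" "\<And>y. y \<in> T \<Longrightarrow> 0 \<le> p y" "sum p T = prob E"
  shows "\<exists>k. (\<forall>\<omega>\<in>E. k \<omega> \<in> T) \<and>
    (\<forall>y\<in>T. {\<omega> \<in> E. k \<omega> = y} \<in> events \<and> prob {\<omega> \<in> E. k \<omega> = y} = p y)"
  using assms
proof (induction T arbitrary: E rule: finite_ne_induct)
  case (singleton y)
  then show ?case by (intro exI[of _ "\<lambda>_. y"]) auto
next
  case (insert y T)
  have nn: "0 \<le> sum p T" using insert.prems by (intro sum_nonneg) auto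
  then have "p y \<le> prob E" using insert.prems(3) insert.hyps by simp
  then obtain E' where E': "E' \<in> events" "E' \<subseteq> E" "prob E' = p y"
    using split_event[of E "p y"] insert.prems by auto
  have "prob (E - E') = prob E - prob E'"
    using E' insert.prems by (intro finite_measure_Diff) auto
  then have "sum p T = prob (E - E')"
    using E' insert.prems(3) insert.hyps by simp
  then obtain k where k: "\<forall>\<omega>\<in>E - E'. k \<omega> \<in> T"
    "\<forall>z\<in>T. {\<omega> \<in> E - E'. k \<omega> = z} \<in> events \<and> prob {\<omega> \<in> E - E'. k \<omega> = z} = p z"
    using insert.IH[of "E - E'"] insert.prems E' by auto
  define k' where "k' \<omega> = (if \<omega> \<in> E' then y else k \<omega>)" for \<omega>
  have 1: "{\<omega> \<in> E. k' \<omega> = y} = E'"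
    using k(1) insert.hyps E' by (auto simp: k'_def split: if_splits)
  have 2: "{\<omega> \<in> E. k' \<omega> = z} = {\<omega> \<in> E - E'. k \<omega> = z}" if "z \<in> T" for z
    using that insert.hyps by (auto simp: k'_def)
  show ?case
  proof (intro exI[of _ k'] conjI ballI)
    fix \<omega> assume "\<omega> \<in> E" then show "k' \<omega> \<in> insert y T" using k(1) by (auto simp: k'_def)
  next
    fix z assume "z \<in> insert y T"
    then show "{\<omega> \<in> E. k' \<omega> = z} \<in> events" "prob {\<omega> \<in> E. k' \<omega> = z} = p z"
      using 1 2[of z] k(2) E' by auto
  qed
qed

lemma measurable_finite_range:
  assumes "finite T" "\<And>\<omega>. \<omega> \<in> space M \<Longrightarrow> f \<omega> \<in> T" "T \<subseteq> space N"
    and "\<And>y. y \<in> T \<Longrightarrow> {\<omega> \<in> space M. f \<omega> = y} \<in> sets M"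
  shows "f \<in> measurable M N"
proof (rule measurableI)
  fix A
  have "f -` A \<inter> space M = (\<Union>y\<in>T \<inter> A. {\<omega> \<in> space M. f \<omega> = y})"
    using assms(2) by auto
  then show "f -` A \<inter> space M \<in> sets M"
    using assms(1,4) by auto
qed (use assms in auto)

text \<open>
  On the event \<open>g = x\<close>, whose probability is the total of the row \<open>\<pi> x\<close>, the new variable is
  distributed over \<open>T\<close> according to that row.
\<close>

lemma (in atomless_prob_space) realize_transport_plan:
  fixes g :: "'a \<Rightarrow> 'x::metric_space" and \<pi> :: "'x \<Rightarrow> 'x \<Rightarrow> real"
  assumes g: "g \<in> borel_measurable M" "finite S" "\<And>\<omega>. \<omega> \<in> space M \<Longrightarrow> g \<omega> \<in> S"
    and T: "finite T" "T \<noteq> {}"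
    and nn: "\<And>x y. x \<in> S \<Longrightarrow> y \<in> T \<Longrightarrow> 0 \<le> \<pi> x y"
    and marg: "\<And>x. x \<in> S \<Longrightarrow> (\<Sum>y\<in>T. \<pi> x y) = prob {\<omega> \<in> space M. g \<omega> = x}"
  shows "\<exists>g'\<in>borel_measurable M. (\<forall>\<omega>\<in>space M. g' \<omega> \<in> T) \<and>
    (\<forall>x\<in>S. \<forall>y\<in>T. prob {\<omega> \<in> space M. g \<omega> = x \<and> g' \<omega> = y} = \<pi> x y)"
proof -
  define E where "E x = {\<omega> \<in> space M. g \<omega> = x}" for x
  have E: "E x \<in> events" for x
    unfolding E_def using g(1) by measurable
  have "\<forall>x\<in>S. \<exists>k. (\<forall>\<omega>\<in>E x. k \<omega> \<in> T) \<and>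
    (\<forall>y\<in>T. {\<omega> \<in> E x. k \<omega> = y} \<in> events \<and> prob {\<omega> \<in> E x. k \<omega> = y} = \<pi> x y)"
    using partition_event[OF T E] nn marg by (simp add: E_def)
  from bchoice[OF this] obtain k where k: "\<forall>x\<in>S. (\<forall>\<omega>\<in>E x. k x \<omega> \<in> T) \<and>
    (\<forall>y\<in>T. {\<omega> \<in> E x. k x \<omega> = y} \<in> events \<and> prob {\<omega> \<in> E x. k x \<omega> = y} = \<pi> x y)"
    by (rule exE)
  define g' where "g' \<omega> = k (g \<omega>) \<omega>" for \<omega>
  have joint: "{\<omega> \<in> space M. g \<omega> = x \<and> g' \<omega> = y} = {\<omega> \<in> E x. k x \<omega> = y}" for x y
    by (auto simp: g'_def E_def)
  have inT: "g' \<omega> \<in> T" if "\<omega> \<in> space M" for \<omega>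
    unfolding g'_def using that g(3) k by (auto simp: E_def)
  have "{\<omega> \<in> space M. g' \<omega> = y} \<in> events" if "y \<in> T" for y
  proof -
    have "{\<omega> \<in> space M. g' \<omega> = y} = (\<Union>x\<in>S. {\<omega> \<in> space M. g \<omega> = x \<and> g' \<omega> = y})"
      using g(3) by auto
    then show ?thesis using k that g(2) by (auto simp: joint)
  qed
  then have "g' \<in> borel_measurable M"
    using T(1) inT by (intro measurable_finite_range) auto
  then show ?thesis
    using inT k by (intro bexI[of _ g']) (auto simp: joint)
qed

section \<open>Neighbourhoods and finitely supported measures in the weak topology\<close>

lemma prob_measures_distr:
  assumes "prob_space M" "g \<in> borel_measurable M"
  shows "distr M borel g \<in> prob_measures"
  using prob_space.prob_space_distr[OF assms] by (simp add: prob_measures_def)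

lemma prob_measures_borel_measurable:
  fixes \<tau> :: "'a::polish_space \<Rightarrow> 'b::topological_space"
  assumes "\<mu> \<in> prob_measures" "continuous_on UNIV \<tau>"
  shows "\<tau> \<in> borel_measurable \<mu>"
proof -
  have "sets \<mu> = sets borel" using assms(1) by (simp add: prob_measures_def)
  then show ?thesis
    using borel_measurable_continuous_onI[OF assms(2)] measurable_cong_sets[of \<mu> borel borel borel] by blast
qed

lemma prob_measures_distr_continuous:
  fixes \<tau> :: "'a::polish_space \<Rightarrow> 'b::polish_space"
  assumes "\<mu> \<in> prob_measures" "continuous_on UNIV \<tau>"
  shows "distr \<mu> borel \<tau> \<in> prob_measures"
  using assms prob_measures_distr[OF _ prob_measures_borel_measurable[OF assms]]
  by (simp add: prob_measures_def)

text \<open>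
  All estimates on the weak topology go through these neighbourhoods, given by finitely many test
  functions and one tolerance.
\<close>

lemma prob_topology_nhd:
  assumes "openin prob_topology W" "\<mu> \<in> W"
  shows "\<exists>F \<epsilon>. finite F \<and> 0 < (\<epsilon>::real) \<and> (\<forall>f\<in>F. continuous_on UNIV f \<and> bounded (range f)) \<and>
     (\<forall>\<nu>\<in>prob_measures. (\<forall>f\<in>F. \<bar>(\<integral>x. f x \<partial>\<nu>) - (\<integral>x. f x \<partial>\<mu>)\<bar> < \<epsilon>) \<longrightarrow> \<nu> \<in> W)"
proof -
  have "generate_topology_on
      {{\<mu> \<in> prob_measures. (\<integral>x. f x \<partial>\<mu>) \<in> V} | f V.
        continuous_on UNIV f \<and> bounded (range f) \<and> open (V :: real set)} W"
    using assms(1) unfolding prob_topology_def by (rule openin_topology_generated_by)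
  then show ?thesis
    using assms(2)
  proof (induction rule: generate_topology_on.induct)
    case Empty
    then show ?case by simp
  next
    case (Int A B)
    from Int.prems have \<mu>: "\<mu> \<in> A" "\<mu> \<in> B" by auto
    from Int.IH(1)[OF \<mu>(1)] obtain F1 and e1 :: real where
      1: "finite F1" "0 < e1" "\<forall>f\<in>F1. continuous_on UNIV f \<and> bounded (range f)"
       "\<forall>\<nu>\<in>prob_measures. (\<forall>f\<in>F1. \<bar>(\<integral>x. f x \<partial>\<nu>) - (\<integral>x. f x \<partial>\<mu>)\<bar> < e1) \<longrightarrow> \<nu> \<in> A"
      by (elim exE conjE)
    from Int.IH(2)[OF \<mu>(2)] obtain F2 and e2 :: real where
      2: "finite F2" "0 < e2" "\<forall>f\<in>F2. continuous_on UNIV f \<and> bounded (range f)"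
       "\<forall>\<nu>\<in>prob_measures. (\<forall>f\<in>F2. \<bar>(\<integral>x. f x \<partial>\<nu>) - (\<integral>x. f x \<partial>\<mu>)\<bar> < e2) \<longrightarrow> \<nu> \<in> B"
      by (elim exE conjE)
    show ?case
    proof (intro exI[of _ "F1 \<union> F2"] exI[of _ "min e1 e2"] conjI ballI impI)
      fix \<nu> assume \<nu>: "\<nu> \<in> prob_measures"
        and close: "\<forall>f\<in>F1 \<union> F2. \<bar>(\<integral>x. f x \<partial>\<nu>) - (\<integral>x. f x \<partial>\<mu>)\<bar> < min e1 e2"
      have "\<forall>f\<in>F1. \<bar>(\<integral>x. f x \<partial>\<nu>) - (\<integral>x. f x \<partial>\<mu>)\<bar> < e1"
           "\<forall>f\<in>F2. \<bar>(\<integral>x. f x \<partial>\<nu>) - (\<integral>x. f x \<partial>\<mu>)\<bar> < e2"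
        using close by simp_all
      then show "\<nu> \<in> A \<inter> B" using 1(4) 2(4) \<nu> by simp
    qed (use 1(1-3) 2(1-3) in blast | use 1(2) 2(2) in simp)+
  next
    case (UN K)
    then obtain k where k: "k \<in> K" "\<mu> \<in> k" by auto
    from UN.IH[OF k] obtain F and e :: real where
      1: "finite F" "0 < e" "\<forall>f\<in>F. continuous_on UNIV f \<and> bounded (range f)"
       "\<forall>\<nu>\<in>prob_measures. (\<forall>f\<in>F. \<bar>(\<integral>x. f x \<partial>\<nu>) - (\<integral>x. f x \<partial>\<mu>)\<bar> < e) \<longrightarrow> \<nu> \<in> k"
      by (elim exE conjE)
    have "\<forall>\<nu>\<in>prob_measures. (\<forall>f\<in>F. \<bar>(\<integral>x. f x \<partial>\<nu>) - (\<integral>x. f x \<partial>\<mu>)\<bar> < e) \<longrightarrow> \<nu> \<in> \<Union>K"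
      using 1(4) k(1) by blast
    then show ?case
      using 1(1-3) by (intro exI[of _ F] exI[of _ e] conjI)
  next
    case (Basis s)
    then obtain f V where f: "continuous_on UNIV f" "bounded (range f)" "open (V::real set)"
      and s: "s = {\<mu> \<in> prob_measures. (\<integral>x. f x \<partial>\<mu>) \<in> V}" by blast
    then obtain e where "0 < e" "\<forall>y. dist y (\<integral>x. f x \<partial>\<mu>) < e \<longrightarrow> y \<in> V"
      using Basis by (auto simp: open_dist)
    then show ?case using f s
      by (intro exI[of _ "{f}"] exI[of _ e]) (auto simp: dist_real_def)
  qed
qed

lemma integrable_bounded_continuous:
  fixes f :: "'a::polish_space \<Rightarrow> real"
  assumes "\<mu> \<in> prob_measures" "continuous_on UNIV f" "bounded (range f)"
  shows "integrable \<mu> f"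
proof -
  interpret prob_space \<mu> using assms by (simp add: prob_measures_def)
  obtain B where "\<And>x. \<bar>f x\<bar> \<le> B" using assms(3) by (auto simp: bounded_iff)
  moreover have "f \<in> borel_measurable \<mu>"
    by (rule prob_measures_borel_measurable[OF assms(1,2)])
  ultimately show ?thesis by (intro integrable_const_bound[of _ B]) auto
qed

text \<open>
  A basic neighbourhood involves only finitely many bounded test functions. Rounding their values
  cuts the space into finitely many Borel pieces on which every test function is nearly constant;
  moving the mass of each piece to one of its points changes no test integral by much.
\<close>

lemma prob_topology_finite_support_dense:
  fixes W :: "'a::polish_space measure set"
  assumes "openin prob_topology W" "W \<noteq> {}"
  obtains \<nu> T where "\<nu> \<in> W" "\<nu> \<in> prob_measures" "finite T" "emeasure \<nu> (-T) = 0"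
proof -
  obtain \<mu> where \<mu>W: "\<mu> \<in> W" using assms(2) by auto
  then have \<mu>: "\<mu> \<in> prob_measures"
    using openin_subset[OF assms(1)] by (auto simp: topspace_prob_topology)
  interpret prob_space \<mu> using \<mu> by (simp add: prob_measures_def)
  have sets: "sets \<mu> = sets borel" using \<mu> by (simp add: prob_measures_def)
  have space [simp]: "space \<mu> = UNIV" using sets_eq_imp_space_eq[OF sets] by simp
  from prob_topology_nhd[OF assms(1) \<mu>W]
  obtain F and \<epsilon> :: real where F: "finite F" "0 < \<epsilon>"
    and F0: "\<forall>f\<in>F. continuous_on UNIV f \<and> bounded (range f)"
    and W: "\<forall>\<nu>\<in>prob_measures. (\<forall>f\<in>F. \<bar>(\<integral>x. f x \<partial>\<nu>) - (\<integral>x. f x \<partial>\<mu>)\<bar> < \<epsilon>) \<longrightarrow> \<nu> \<in> W"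
    by (elim exE conjE)
  have F': "continuous_on UNIV f" "bounded (range f)" if "f \<in> F" for f
    using F0 that by auto
  have meas: "f \<in> borel_measurable borel" if "f \<in> F" for f
    using F'(1)[OF that] by (rule borel_measurable_continuous_onI)
  define \<eta> where "\<eta> = \<epsilon> / 2"
  have \<eta>: "0 < \<eta>" "\<eta> < \<epsilon>" using F by (auto simp: \<eta>_def)
  \<comment> \<open>The piece of \<open>x\<close>: the test values at \<open>x\<close>, rounded to multiples of \<open>\<eta>\<close>.\<close>
  define q where "q x = restrict (\<lambda>f. \<lfloor>f x / \<eta>\<rfloor>) F" for x
  have fin: "finite (range q)"
  proof (rule finite_subset)
    have "finite ((\<lambda>x. \<lfloor>f x / \<eta>\<rfloor>) ` UNIV)" if f: "f \<in> F" for f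
    proof -
      obtain B where B: "\<And>x. \<bar>f x\<bar> \<le> B" using F'(2)[OF f] by (auto simp: bounded_iff)
      have "\<lfloor>-B / \<eta>\<rfloor> \<le> \<lfloor>f x / \<eta>\<rfloor> \<and> \<lfloor>f x / \<eta>\<rfloor> \<le> \<lfloor>B / \<eta>\<rfloor>" for x
        using B[of x] \<eta> by (intro conjI floor_mono divide_right_mono) auto
      then have "(\<lambda>x. \<lfloor>f x / \<eta>\<rfloor>) ` UNIV \<subseteq> {\<lfloor>-B / \<eta>\<rfloor>..\<lfloor>B / \<eta>\<rfloor>}" by auto
      then show ?thesis using finite_subset by blast
    qed
    then show "finite (PiE F (\<lambda>f. (\<lambda>x. \<lfloor>f x / \<eta>\<rfloor>) ` UNIV))"
      using F by (intro finite_PiE) auto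
  qed (auto simp: q_def)
  \<comment> \<open>The map that retracts each piece to one of its points.\<close>
  define s where "s x = inv q (q x)" for x
  have qs: "q (s x) = q x" for x unfolding s_def by (intro f_inv_into_f) auto
  have s_close: "\<bar>f (s x) - f x\<bar> \<le> \<eta>" if f: "f \<in> F" for f x
  proof -
    have "\<lfloor>f (s x) / \<eta>\<rfloor> = \<lfloor>f x / \<eta>\<rfloor>"
      using fun_cong[OF qs[of x], of f] f by (simp add: q_def)
    then have "\<bar>f (s x) / \<eta> - f x / \<eta>\<bar> \<le> 1" by linarith
    then have "\<bar>(f (s x) - f x) / \<eta>\<bar> \<le> 1" by (simp add: diff_divide_distrib)
    then show ?thesis using \<eta> by (simp add: abs_divide)
  qed
  have q_sets: "{x. q x = v} \<in> sets borel" for v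
  proof (cases "v \<in> extensional F")
    case True
    have "{x. q x = v} = {x\<in>space borel. \<forall>f\<in>F. \<lfloor>f x / \<eta>\<rfloor> = v f}"
      using True by (auto simp: q_def fun_eq_iff extensional_def)
    also have "\<dots> \<in> sets borel"
      using meas F by (intro sets.sets_Collect_finite_All) auto
    finally show ?thesis .
  next
    case False
    then have "{x. q x = v} = {}" by (auto simp: q_def)
    then show ?thesis by simp
  qed
  have fin_s: "finite (range s)"
  proof -
    have "range s = inv q ` range q" by (auto simp: s_def)
    then show ?thesis using fin by simp
  qed
  have s_meas: "s \<in> borel_measurable \<mu>"
  proof (rule measurable_finite_range[OF fin_s])
    fix y assume "y \<in> range s"
    then obtain z where z: "y = s z" by auto
    have "s x = y \<longleftrightarrow> q x = q y" for x
    proof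
      assume "s x = y" then show "q x = q y" using qs[of x] by simp
    next
      assume "q x = q y" then have "q x = q z" using qs[of z] z by simp
      then show "s x = y" unfolding z by (simp add: s_def)
    qed
    then have "{x \<in> space \<mu>. s x = y} = {x. q x = q y}" by simp
    then show "{x \<in> space \<mu>. s x = y} \<in> events" using q_sets sets by simp
  qed auto
  define \<nu> where "\<nu> = distr \<mu> borel s"
  have \<nu>: "\<nu> \<in> prob_measures"
    unfolding \<nu>_def using s_meas prob_measures_distr prob_space_axioms by blast
  have "\<nu> \<in> W"
  proof (rule W[rule_format, OF \<nu>])
    fix f assume f: "f \<in> F"
    have int: "integrable \<nu> f" "integrable \<mu> f"
      using integrable_bounded_continuous \<nu> \<mu> F' f by blast+
    have ints: "integrable \<mu> (\<lambda>x. f (s x))"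
      using int(1) meas[OF f] s_meas unfolding \<nu>_def by (subst (asm) integrable_distr_eq) auto
    have "(\<integral>x. f x \<partial>\<nu>) = (\<integral>x. f (s x) \<partial>\<mu>)"
      unfolding \<nu>_def using meas[OF f] s_meas by (intro integral_distr) auto
    then have "\<bar>(\<integral>x. f x \<partial>\<nu>) - (\<integral>x. f x \<partial>\<mu>)\<bar> = \<bar>\<integral>x. f (s x) - f x \<partial>\<mu>\<bar>"
      using int ints by simp
    also have "\<dots> \<le> (\<integral>x. \<bar>f (s x) - f x\<bar> \<partial>\<mu>)" by (rule integral_abs_bound)
    also have "\<dots> \<le> (\<integral>x. \<eta> \<partial>\<mu>)"
      using int ints s_close[OF f] by (intro integral_mono) auto
    also have "\<dots> = \<eta>" using prob_space by simp
    finally show "\<bar>(\<integral>x. f x \<partial>\<nu>) - (\<integral>x. f x \<partial>\<mu>)\<bar> < \<epsilon>" using \<eta> by simp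
  qed
  moreover have "emeasure \<nu> (- range s) = 0"
  proof -
    have "- range s \<in> sets borel" using fin_s by (simp add: finite_imp_closed borel_open open_Compl)
    then have "emeasure \<nu> (- range s) = emeasure \<mu> (s -` (- range s) \<inter> space \<mu>)"
      unfolding \<nu>_def using s_meas by (intro emeasure_distr) auto
    also have "s -` (- range s) \<inter> space \<mu> = {}" by auto
    finally show ?thesis by simp
  qed
  ultimately show ?thesis using that \<nu> fin_s by blast
qed

section \<open>Transport between finitely supported measures\<close>

text \<open>
  Here \<open>w\<close> and \<open>v\<close> are the weights of two finitely supported probability measures, and \<open>B x\<close> is
  a neighbourhood of \<open>x\<close>. If \<open>v\<close> gives each neighbourhood nearly the mass that \<open>w\<close> gives its
  centre, then \<open>w\<close> can be transported to \<open>v\<close> with all but the fraction \<open>\<epsilon>\<close> of the mass staying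
  nearby. A part \<open>1 - \<epsilon>\<close> of the mass at \<open>x\<close> is spread over \<open>B x\<close> in proportion to \<open>v\<close>; the
  assumption guarantees that this does not exceed \<open>v\<close> anywhere. The remaining part of every atom
  is distributed according to the deficit \<open>\<rho>\<close> that is left over, independently of \<open>x\<close>.
\<close>

lemma near_diagonal_transport_plan:
  fixes w v :: "'x \<Rightarrow> real" and B :: "'x \<Rightarrow> 'x set"
  assumes fin: "finite S" "finite T"
    and w: "\<And>x. x \<in> S \<Longrightarrow> 0 \<le> w x" "sum w S = 1"
    and v: "\<And>y. y \<in> T \<Longrightarrow> 0 \<le> v y" "sum v T = 1"
    and \<epsilon>: "0 < \<epsilon>" "\<epsilon> < 1"
    and disj: "disjoint_family_on B S"
    and heavy: "\<And>x. x \<in> S \<Longrightarrow> (1 - \<epsilon>) * w x \<le> sum v (T \<inter> B x)"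
  shows "\<exists>\<pi>. (\<forall>x\<in>S. \<forall>y\<in>T. 0 \<le> \<pi> x y) \<and> (\<forall>x\<in>S. (\<Sum>y\<in>T. \<pi> x y) = w x) \<and>
    (\<forall>y\<in>T. (\<Sum>x\<in>S. \<pi> x y) = v y) \<and> (\<Sum>x\<in>S. \<Sum>y\<in>T - B x. \<pi> x y) \<le> \<epsilon>"
proof -
  define b where "b x = sum v (T \<inter> B x)" for x
  \<comment> \<open>The measure \<open>v\<close> conditioned on \<open>B x\<close>.\<close>
  define c where "c x y = (if y \<in> B x then v y / b x else 0)" for x y
  \<comment> \<open>What arrives at \<open>y\<close> if all mass is spread locally; \<open>\<rho>\<close> is what \<open>v\<close> still lacks after the fraction \<open>1 - \<epsilon>\<close> of it.\<close>
  define \<sigma> where "\<sigma> y = (\<Sum>x\<in>S. w x * c x y)" for y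
  define \<rho> where "\<rho> y = v y - (1 - \<epsilon>) * \<sigma> y" for y
  define \<pi> where "\<pi> x y = w x * ((1 - \<epsilon>) * c x y + \<rho> y)" for x y
  have b_nn: "0 \<le> b x" for x unfolding b_def using v(1) by (intro sum_nonneg) auto
  have c_nn: "0 \<le> c x y" if "y \<in> T" for x y using that v(1) b_nn by (simp add: c_def)
  have b_pos: "0 < b x" if "x \<in> S" "w x \<noteq> 0" for x
  proof -
    have "0 < (1 - \<epsilon>) * w x" using that w(1)[of x] \<epsilon> by (intro mult_pos_pos) auto
    then show ?thesis using heavy[OF that(1)] by (simp add: b_def)
  qed
  \<comment> \<open>The factor \<open>w x\<close> covers the points of weight 0, where \<open>b x\<close> may vanish and \<open>c x\<close> need not have total 1.\<close>
  have c_sum: "w x * (\<Sum>y\<in>T. c x y) = w x" if "x \<in> S" for x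
  proof (cases "w x = 0")
    case False
    have "(\<Sum>y\<in>T. c x y) = (\<Sum>y\<in>T \<inter> B x. v y / b x)"
      unfolding c_def using fin by (simp add: sum.inter_restrict)
    also have "\<dots> = 1"
      using b_pos[OF that False] by (simp add: b_def flip: sum_divide_distrib)
    finally show ?thesis by simp
  qed simp
  have \<sigma>_sum: "(\<Sum>y\<in>T. \<sigma> y) = 1"
  proof -
    have "(\<Sum>y\<in>T. \<sigma> y) = (\<Sum>x\<in>S. \<Sum>y\<in>T. w x * c x y)"
      unfolding \<sigma>_def by (rule sum.swap)
    also have "\<dots> = (\<Sum>x\<in>S. w x)"
      using c_sum by (intro sum.cong) (auto simp flip: sum_distrib_left)
    finally show ?thesis using w by simp
  qed
  have \<rho>_nn: "0 \<le> \<rho> y" if y: "y \<in> T" for y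
  proof (cases "\<exists>x\<in>S. y \<in> B x")
    case True
    then obtain x where x: "x \<in> S" "y \<in> B x" by auto
    have "c z y = 0" if "z \<in> S - {x}" for z
      using disj that x by (auto simp: disjoint_family_on_def c_def)
    then have "\<sigma> y = w x * c x y"
      unfolding \<sigma>_def using fin x by (subst sum.remove[of S x]) auto
    moreover have "(1 - \<epsilon>) * (w x * c x y) \<le> v y"
    proof (cases "w x = 0")
      case False
      have "((1 - \<epsilon>) * w x) * (v y / b x) \<le> b x * (v y / b x)"
        using heavy[OF x(1)] b_nn v(1)[OF y] by (intro mult_right_mono) (auto simp: b_def)
      also have "\<dots> = v y" using b_pos[OF x(1) False] by simp
      finally show ?thesis using x by (simp add: c_def)
    qed (use v(1)[OF y] in simp)
    ultimately show ?thesis by (simp add: \<rho>_def)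
  next
    case False
    then have "\<sigma> y = 0" unfolding \<sigma>_def c_def by (intro sum.neutral) auto
    then show ?thesis using v(1)[OF y] by (simp add: \<rho>_def)
  qed
  have \<rho>_sum: "(\<Sum>y\<in>T. \<rho> y) = \<epsilon>"
    unfolding \<rho>_def by (simp add: sum_subtractf \<sigma>_sum v(2) flip: sum_distrib_left)
  show ?thesis
  proof (intro exI[of _ \<pi>] conjI ballI)
    fix x y assume "x \<in> S" "y \<in> T"
    then show "0 \<le> \<pi> x y"
      unfolding \<pi>_def using w(1) c_nn \<rho>_nn \<epsilon> by (intro mult_nonneg_nonneg add_nonneg_nonneg) auto
  next
    fix x assume x: "x \<in> S"
    have "(\<Sum>y\<in>T. \<pi> x y) = (1 - \<epsilon>) * (w x * (\<Sum>y\<in>T. c x y)) + w x * (\<Sum>y\<in>T. \<rho> y)"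
      unfolding \<pi>_def sum_distrib_left sum.distrib[symmetric]
      by (intro sum.cong) (auto simp: algebra_simps)
    then show "(\<Sum>y\<in>T. \<pi> x y) = w x"
      by (simp add: c_sum[OF x] \<rho>_sum algebra_simps)
  next
    fix y assume y: "y \<in> T"
    have "(\<Sum>x\<in>S. \<pi> x y) = (1 - \<epsilon>) * \<sigma> y + (\<Sum>x\<in>S. w x) * \<rho> y"
      unfolding \<pi>_def \<sigma>_def sum_distrib_left sum_distrib_right sum.distrib[symmetric]
      by (intro sum.cong) (auto simp: algebra_simps)
    then show "(\<Sum>x\<in>S. \<pi> x y) = v y" by (simp add: w(2) \<rho>_def)
  next
    have "(\<Sum>x\<in>S. \<Sum>y\<in>T - B x. \<pi> x y) = (\<Sum>x\<in>S. w x * (\<Sum>y\<in>T - B x. \<rho> y))"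
      unfolding \<pi>_def sum_distrib_left by (intro sum.cong) (auto simp: c_def)
    also have "\<dots> \<le> (\<Sum>x\<in>S. w x * \<epsilon>)"
    proof (intro sum_mono mult_left_mono)
      fix x assume "x \<in> S"
      show "(\<Sum>y\<in>T - B x. \<rho> y) \<le> \<epsilon>"
        unfolding \<rho>_sum[symmetric] using fin \<rho>_nn by (intro sum_mono2) auto
    qed (use w in auto)
    also have "\<dots> = \<epsilon>" by (simp add: w(2) flip: sum_distrib_right)
    finally show "(\<Sum>x\<in>S. \<Sum>y\<in>T - B x. \<pi> x y) \<le> \<epsilon>" .
  qed
qed

lemma emeasure_finite_support:
  fixes \<mu> :: "'a::polish_space measure"
  assumes "\<mu> \<in> prob_measures" "finite T" "emeasure \<mu> (- T) = 0" "A \<in> sets borel"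
  shows "emeasure \<mu> A = (\<Sum>y\<in>T \<inter> A. emeasure \<mu> {y})"
proof -
  have sets: "sets \<mu> = sets borel" using assms(1) by (simp add: prob_measures_def)
  have T: "T \<in> sets borel" using assms(2) by (simp add: finite_imp_closed borel_closed)
  have null: "- T \<in> null_sets \<mu>" 
    using T by (intro null_setsI[OF assms(3)]) (simp add: sets)
  have "emeasure \<mu> A = emeasure \<mu> (A - (- T))"
    using emeasure_Diff_null_set[OF null, of A] assms(4) unfolding sets by metis
  also have "A - (- T) = T \<inter> A" by auto
  also have "emeasure \<mu> (T \<inter> A) = (\<Sum>y\<in>T \<inter> A. emeasure \<mu> {y})"
    using assms(2) sets by (intro emeasure_eq_sum_singleton) auto
  finally show ?thesis .
qed

lemma measure_finite_support:
  fixes \<mu> :: "'a::polish_space measure"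
  assumes "\<mu> \<in> prob_measures" "finite T" "emeasure \<mu> (- T) = 0" "A \<in> sets borel"
  shows "measure \<mu> A = (\<Sum>y\<in>T \<inter> A. measure \<mu> {y})"
proof -
  interpret prob_space \<mu> using assms(1) by (simp add: prob_measures_def)
  show ?thesis
    using emeasure_finite_support[OF assms]
    by (simp add: emeasure_eq_measure sum_ennreal sum_nonneg)
qed

text \<open>
  A coupling of the law of \<open>g\<close> with \<open>\<nu>\<close> is turned into a random variable with law exactly \<open>\<nu>\<close>,
  living on the same space as \<open>g\<close> and having the prescribed joint law with it.
\<close>

lemma (in atomless_prob_space) realize_finite_coupling:
  fixes g :: "'a \<Rightarrow> 'x::polish_space" and \<pi> :: "'x \<Rightarrow> 'x \<Rightarrow> real"
  assumes g: "g \<in> borel_measurable M" "finite S" "\<And>\<omega>. \<omega> \<in> space M \<Longrightarrow> g \<omega> \<in> S"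
    and \<nu>: "\<nu> \<in> prob_measures" "finite T" "emeasure \<nu> (- T) = 0"
    and nn: "\<And>x y. x \<in> S \<Longrightarrow> y \<in> T \<Longrightarrow> 0 \<le> \<pi> x y"
    and marg1: "\<And>x. x \<in> S \<Longrightarrow> (\<Sum>y\<in>T. \<pi> x y) = prob {\<omega> \<in> space M. g \<omega> = x}"
    and marg2: "\<And>y. y \<in> T \<Longrightarrow> (\<Sum>x\<in>S. \<pi> x y) = measure \<nu> {y}"
  shows "\<exists>g'\<in>borel_measurable M. (\<forall>\<omega>\<in>space M. g' \<omega> \<in> T) \<and> distr M borel g' = \<nu> \<and>
    (\<forall>x\<in>S. \<forall>y\<in>T. prob {\<omega> \<in> space M. g \<omega> = x \<and> g' \<omega> = y} = \<pi> x y)"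
proof -
  interpret \<nu>: prob_space \<nu> using \<nu> by (simp add: prob_measures_def)
  have sets_\<nu>: "sets \<nu> = sets borel" using \<nu>(1) by (simp add: prob_measures_def)
  have space_\<nu>: "space \<nu> = UNIV" using sets_eq_imp_space_eq[OF sets_\<nu>] by simp
  have "T \<noteq> {}" using \<nu>(3) \<nu>.emeasure_space_1 by (auto simp: space_\<nu>)
  have "\<exists>g'\<in>borel_measurable M. (\<forall>\<omega>\<in>space M. g' \<omega> \<in> T) \<and>
    (\<forall>x\<in>S. \<forall>y\<in>T. prob {\<omega> \<in> space M. g \<omega> = x \<and> g' \<omega> = y} = \<pi> x y)"
    by (rule realize_transport_plan) (fact g \<nu>(2) \<open>T \<noteq> {}\<close> nn marg1)+
  then obtain g' where g'_meas: "g' \<in> borel_measurable M" and g'_T: "\<forall>\<omega>\<in>space M. g' \<omega> \<in> T"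
    and joint: "\<forall>x\<in>S. \<forall>y\<in>T. prob {\<omega> \<in> space M. g \<omega> = x \<and> g' \<omega> = y} = \<pi> x y"
    by (elim bexE conjE)
  note g' = g'_meas g'_T[rule_format]
  have [measurable]: "g \<in> borel_measurable M" "g' \<in> borel_measurable M" by fact+
  have law: "distr M borel g' \<in> prob_measures"
    by (rule prob_measures_distr[OF prob_space_axioms g'(1)])
  have supp: "emeasure (distr M borel g') (- T) = 0"
  proof -
    have "- T \<in> sets borel" using \<nu>(2) by (simp add: finite_imp_closed borel_closed)
    then have "emeasure (distr M borel g') (- T) = emeasure M (g' -` (- T) \<inter> space M)"
      by (intro emeasure_distr) auto
    also have "g' -` (- T) \<inter> space M = {}" using g'(2) by auto
    finally show ?thesis by simp
  qed
  have point: "emeasure (distr M borel g') {y} = emeasure \<nu> {y}" if y: "y \<in> T" for y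
  proof -
    have "emeasure (distr M borel g') {y} = prob (g' -` {y} \<inter> space M)"
      by (subst emeasure_distr) (auto simp: emeasure_eq_measure)
    also have "g' -` {y} \<inter> space M = (\<Union>x\<in>S. {\<omega> \<in> space M. g \<omega> = x \<and> g' \<omega> = y})"
      using g(3) by auto
    also have "prob \<dots> = (\<Sum>x\<in>S. prob {\<omega> \<in> space M. g \<omega> = x \<and> g' \<omega> = y})"
      using g(2) by (intro finite_measure_finite_Union) (auto simp: disjoint_family_on_def)
    also have "\<dots> = measure \<nu> {y}" using joint y marg2 by simp
    finally show ?thesis by (simp add: \<nu>.emeasure_eq_measure)
  qed
  have "distr M borel g' = \<nu>"
  proof (rule measure_eqI)
    fix A assume "A \<in> sets (distr M borel g')"
    then have A: "A \<in> sets borel" by simp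
    show "emeasure (distr M borel g') A = emeasure \<nu> A"
      unfolding emeasure_finite_support[OF law \<nu>(2) supp A] emeasure_finite_support[OF \<nu> A]
      using point by (intro sum.cong) auto
  qed (simp add: sets_\<nu>)
  then show ?thesis using g' joint by (intro bexI[of _ g']) auto
qed

section \<open>Convergence in probability and weak convergence\<close>

text \<open>
  Finitely many conditions that hold for small radii, and persist when the radius shrinks, hold
  simultaneously for some radius.
\<close>

lemma common_radius:
  assumes "finite I" "\<And>i. i \<in> I \<Longrightarrow> \<exists>d>0. P i d"
    and "\<And>i d d'. P i d \<Longrightarrow> 0 < d' \<Longrightarrow> d' \<le> d \<Longrightarrow> P i (d' :: real)"
  shows "\<exists>d>0. \<forall>i\<in>I. P i d"
  using assms(1,2)
proof (induction I)
  case empty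
  then show ?case by (intro exI[of _ 1]) auto
next
  case (insert i I)
  obtain d where d: "0 < d" "\<forall>i\<in>I. P i d" using insert by auto
  obtain d' where d': "0 < d'" "P i d'" using insert by auto
  show ?case
    using d d' assms(3)[of _ _ "min d d'"] by (intro exI[of _ "min d d'"]) auto
qed

text \<open>
  Since \<open>g\<close> takes only finitely many values, \<open>f\<close> is uniformly continuous at them: one radius \<open>d\<close>
  serves all values of \<open>g\<close>, although \<open>f\<close> is merely continuous. The event where \<open>g\<close> and \<open>h\<close> are
  far apart contributes at most \<open>2 B\<close> times its probability.
\<close>

lemma (in prob_space) integral_law_close:
  fixes g :: "'a \<Rightarrow> 'x::polish_space" and f :: "'x \<Rightarrow> real"
  assumes f: "continuous_on UNIV f" "bounded (range f)"
    and g: "g \<in> borel_measurable M" "finite S" "\<And>\<omega>. \<omega> \<in> space M \<Longrightarrow> g \<omega> \<in> S"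
    and \<epsilon>: "0 < \<epsilon>"
  shows "\<exists>\<delta>>0. \<forall>h\<in>borel_measurable M. prob {\<omega> \<in> space M. \<delta> \<le> dist (g \<omega>) (h \<omega>)} \<le> \<delta> \<longrightarrow>
    \<bar>(\<integral>x. f x \<partial>distr M borel h) - (\<integral>x. f x \<partial>distr M borel g)\<bar> < \<epsilon>"
proof -
  obtain B where B: "0 < B" "\<And>x. \<bar>f x\<bar> \<le> B"
    using f(2) by (auto simp: bounded_pos)
  have "\<exists>d>0. \<forall>y. dist x y < d \<longrightarrow> \<bar>f y - f x\<bar> \<le> \<epsilon> / 2" for x
  proof -
    have "isCont f x" using f(1) by (simp add: continuous_on_eq_continuous_at)
    then obtain d where d: "0 < d" "\<And>y. dist y x < d \<Longrightarrow> dist (f y) (f x) < \<epsilon> / 2"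
      using \<epsilon> unfolding continuous_at_eps_delta by (meson half_gt_zero)
    show ?thesis
      using d(1) d(2)[simplified dist_real_def] by (intro exI[of _ d]) (auto simp: dist_commute less_imp_le)
  qed
  then have "\<exists>d>0. \<forall>x\<in>S. \<forall>y. dist x y < d \<longrightarrow> \<bar>f y - f x\<bar> \<le> \<epsilon> / 2"
    by (intro common_radius[OF g(2)]) auto
  then obtain d where d: "0 < d" "\<And>x y. x \<in> S \<Longrightarrow> dist x y < d \<Longrightarrow> \<bar>f y - f x\<bar> \<le> \<epsilon> / 2"
    by auto
  define \<delta> where "\<delta> = min d (\<epsilon> / (8 * B))"
  have \<delta>: "0 < \<delta>" "\<delta> \<le> d" "2 * B * \<delta> < \<epsilon> / 2"
  proof -
    show "0 < \<delta>" "\<delta> \<le> d" using d(1) B \<epsilon> by (auto simp: \<delta>_def)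
    have "2 * B * \<delta> \<le> 2 * B * (\<epsilon> / (8 * B))"
      using B by (intro mult_left_mono) (auto simp: \<delta>_def)
    also have "\<dots> = \<epsilon> / 4" using B by simp
    finally show "2 * B * \<delta> < \<epsilon> / 2" using \<epsilon> by simp
  qed
  show ?thesis
  proof (intro exI[of _ \<delta>] conjI ballI impI)
    fix h assume h: "h \<in> borel_measurable M"
      and bad: "prob {\<omega> \<in> space M. \<delta> \<le> dist (g \<omega>) (h \<omega>)} \<le> \<delta>"
    define E where "E = {\<omega> \<in> space M. \<delta> \<le> dist (g \<omega>) (h \<omega>)}"
    have fb: "f \<in> borel_measurable borel" using f(1) by (rule borel_measurable_continuous_onI)
    have E: "E \<in> events" unfolding E_def using g(1) h by measurable
    have int: "integrable M (\<lambda>\<omega>. f (k \<omega>))" if "k \<in> borel_measurable M" for k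
      using B(2) measurable_compose[OF that fb] by (intro integrable_const_bound[of _ B]) auto
    have law: "(\<integral>x. f x \<partial>distr M borel k) = (\<integral>\<omega>. f (k \<omega>) \<partial>M)" if "k \<in> borel_measurable M" for k
      using that fb by (intro integral_distr) auto
    have "(\<integral>x. f x \<partial>distr M borel h) - (\<integral>x. f x \<partial>distr M borel g) = (\<integral>\<omega>. f (h \<omega>) - f (g \<omega>) \<partial>M)"
      using int[OF h] int[OF g(1)] by (simp add: law[OF h] law[OF g(1)])
    then have "\<bar>(\<integral>x. f x \<partial>distr M borel h) - (\<integral>x. f x \<partial>distr M borel g)\<bar> \<le> (\<integral>\<omega>. \<bar>f (h \<omega>) - f (g \<omega>)\<bar> \<partial>M)"
      using integral_abs_bound by metis
    also have "\<dots> \<le> (\<integral>\<omega>. \<epsilon> / 2 + 2 * B * indicator E \<omega> \<partial>M)"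
    proof (rule integral_mono)
      show "integrable M (\<lambda>\<omega>. \<bar>f (h \<omega>) - f (g \<omega>)\<bar>)" using int[OF h] int[OF g(1)] by simp
      show "integrable M (\<lambda>\<omega>. \<epsilon> / 2 + 2 * B * indicator E \<omega>)"
        using E by (simp add: emeasure_eq_measure)
      fix \<omega> assume \<omega>: "\<omega> \<in> space M"
      show "\<bar>f (h \<omega>) - f (g \<omega>)\<bar> \<le> \<epsilon> / 2 + 2 * B * indicator E \<omega>"
      proof (cases "\<omega> \<in> E")
        case True
        then show ?thesis using B(2)[of "h \<omega>"] B(2)[of "g \<omega>"] \<epsilon> by simp
      next
        case False
        then have "dist (g \<omega>) (h \<omega>) < d" using \<omega> \<delta>(2) by (auto simp: E_def)
        then show ?thesis using d(2)[OF g(3)[OF \<omega>]] False by simp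
      qed
    qed
    also have "\<dots> = \<epsilon> / 2 + 2 * B * prob E"
      using E prob_space by (simp add: emeasure_eq_measure)
    also have "\<dots> \<le> \<epsilon> / 2 + 2 * B * \<delta>"
      using bad B(1) by (intro add_left_mono mult_left_mono) (auto simp: E_def)
    finally show "\<bar>(\<integral>x. f x \<partial>distr M borel h) - (\<integral>x. f x \<partial>distr M borel g)\<bar> < \<epsilon>"
      using \<delta>(3) by simp
  qed (use \<delta> in auto)
qed

lemma (in prob_space) far_prob_mono:
  fixes g h :: "'a \<Rightarrow> 'x::polish_space"
  assumes "g \<in> borel_measurable M" "h \<in> borel_measurable M"
    and "d' \<le> d" "prob {\<omega> \<in> space M. d' \<le> dist (g \<omega>) (h \<omega>)} \<le> d'"
  shows "prob {\<omega> \<in> space M. d \<le> dist (g \<omega>) (h \<omega>)} \<le> d"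
proof -
  have "prob {\<omega> \<in> space M. d \<le> dist (g \<omega>) (h \<omega>)} \<le> prob {\<omega> \<in> space M. d' \<le> dist (g \<omega>) (h \<omega>)}"
    using assms by (intro finite_measure_mono) auto
  then show ?thesis using assms by simp
qed

text \<open>
  The map from random variables, under convergence in probability, to their laws is continuous at
  variables with finitely many values. The number \<open>\<delta>\<close> serves both as distance and as
  probability, as in the Ky Fan metric.
\<close>

lemma (in prob_space) law_stable:
  fixes g :: "'a \<Rightarrow> 'x::polish_space"
  assumes W: "openin prob_topology W" "distr M borel g \<in> W"
    and g: "g \<in> borel_measurable M" "finite S" "\<And>\<omega>. \<omega> \<in> space M \<Longrightarrow> g \<omega> \<in> S"
  shows "\<exists>\<delta>>0. \<forall>h\<in>borel_measurable M. prob {\<omega> \<in> space M. \<delta> \<le> dist (g \<omega>) (h \<omega>)} \<le> \<delta> \<longrightarrow> distr M borel h \<in> W"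
proof -
  from prob_topology_nhd[OF W]
  obtain F and \<epsilon> :: real where F: "finite F" "0 < \<epsilon>"
    and cont: "\<forall>f\<in>F. continuous_on UNIV f \<and> bounded (range f)"
    and nhd: "\<forall>\<nu>\<in>prob_measures. (\<forall>f\<in>F. \<bar>(\<integral>x. f x \<partial>\<nu>) - (\<integral>x. f x \<partial>distr M borel g)\<bar> < \<epsilon>) \<longrightarrow> \<nu> \<in> W"
    by (elim exE conjE)
  have "\<exists>\<delta>>0. \<forall>f\<in>F. \<forall>h\<in>borel_measurable M. prob {\<omega> \<in> space M. \<delta> \<le> dist (g \<omega>) (h \<omega>)} \<le> \<delta> \<longrightarrow>
      \<bar>(\<integral>x. f x \<partial>distr M borel h) - (\<integral>x. f x \<partial>distr M borel g)\<bar> < \<epsilon>"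
  proof (rule common_radius[OF F(1)])
    fix f assume "f \<in> F"
    then show "\<exists>\<delta>>0. \<forall>h\<in>borel_measurable M. prob {\<omega> \<in> space M. \<delta> \<le> dist (g \<omega>) (h \<omega>)} \<le> \<delta> \<longrightarrow>
      \<bar>(\<integral>x. f x \<partial>distr M borel h) - (\<integral>x. f x \<partial>distr M borel g)\<bar> < \<epsilon>"
      using cont by (intro integral_law_close[OF _ _ g F(2)]) auto
  next
    fix f d d'
    assume *: "\<forall>h\<in>borel_measurable M. prob {\<omega> \<in> space M. d \<le> dist (g \<omega>) (h \<omega>)} \<le> d \<longrightarrow>
      \<bar>(\<integral>x. f x \<partial>distr M borel h) - (\<integral>x. f x \<partial>distr M borel g)\<bar> < \<epsilon>" and d: "0 < d'" "d' \<le> d"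
    show "\<forall>h\<in>borel_measurable M. prob {\<omega> \<in> space M. d' \<le> dist (g \<omega>) (h \<omega>)} \<le> d' \<longrightarrow>
      \<bar>(\<integral>x. f x \<partial>distr M borel h) - (\<integral>x. f x \<partial>distr M borel g)\<bar> < \<epsilon>"
      using * far_prob_mono[OF g(1) _ d(2)] by blast
  qed
  then obtain \<delta> where \<delta>: "0 < \<delta>" and close: "\<forall>f\<in>F. \<forall>h\<in>borel_measurable M.
      prob {\<omega> \<in> space M. \<delta> \<le> dist (g \<omega>) (h \<omega>)} \<le> \<delta> \<longrightarrow>
      \<bar>(\<integral>x. f x \<partial>distr M borel h) - (\<integral>x. f x \<partial>distr M borel g)\<bar> < \<epsilon>"
    by (elim exE conjE)
  show ?thesis
  proof (intro exI[of _ \<delta>] conjI ballI impI \<delta>)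
    fix h assume "h \<in> borel_measurable M" "prob {\<omega> \<in> space M. \<delta> \<le> dist (g \<omega>) (h \<omega>)} \<le> \<delta>"
    then show "distr M borel h \<in> W"
      using close prob_measures_distr[OF prob_space_axioms] by (intro nhd[rule_format]) auto
  qed
qed

text \<open>
  Completeness of convergence in probability, with explicit rates. Outside the event \<open>B n\<close>, of
  probability at most \<open>\<delta> n / 2\<close>, all later steps are small, so the sequence is Cauchy and stays
  within \<open>\<delta> n / 2\<close> of its \<open>n\<close>-th term. The steps are a quarter of \<open>\<delta> n\<close> because the
  radii at least halve, so that the steps from \<open>n\<close> on add up to at most half of \<open>\<delta> n\<close>.
\<close>

lemma (in prob_space) limit_in_probability:
  fixes g :: "nat \<Rightarrow> 'a \<Rightarrow> 'x::polish_space" and \<delta> :: "nat \<Rightarrow> real"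
  assumes g: "\<And>n. g n \<in> borel_measurable M"
    and \<delta>: "\<And>n. 0 < \<delta> n" "\<And>n. \<delta> (Suc n) \<le> \<delta> n / 2"
    and bad: "\<And>n. prob {\<omega> \<in> space M. \<delta> n / 4 \<le> dist (g n \<omega>) (g (Suc n) \<omega>)} \<le> \<delta> n / 4"
  shows "\<exists>h\<in>borel_measurable M. \<forall>n. prob {\<omega> \<in> space M. \<delta> n \<le> dist (g n \<omega>) (h \<omega>)} \<le> \<delta> n"
proof -
  define E where "E n = {\<omega> \<in> space M. \<delta> n / 4 \<le> dist (g n \<omega>) (g (Suc n) \<omega>)}" for n
  define B where "B n = (\<Union>m. E (n + m))" for n
  have E [measurable]: "E n \<in> events" for n unfolding E_def using g by measurable
  have B [measurable]: "B n \<in> events" for n unfolding B_def by measurable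
  have decay: "\<delta> (n + m) \<le> \<delta> n * (1 / 2) ^ m" for n m
  proof (induction m)
    case (Suc m)
    have "\<delta> (n + Suc m) \<le> \<delta> (n + m) / 2" using \<delta>(2) by simp
    also have "\<dots> \<le> \<delta> n * (1 / 2) ^ m / 2" using Suc by (intro divide_right_mono) auto
    finally show ?case by simp
  qed simp
  have geo: "(\<lambda>m. \<delta> n / 4 * (1 / 2) ^ m) sums (\<delta> n / 2)" for n
    using sums_mult[OF geometric_sums[of "1/2 :: real"], of "\<delta> n / 4"] by simp
  have part: "(\<Sum>i<m. \<delta> n / 4 * (1 / 2) ^ i) \<le> \<delta> n / 2" for n m
    using sum_le_suminf[OF sums_summable[OF geo[of n]], of "{..<m}"] sums_unique[OF geo[of n]] \<delta>(1)[of n]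
    by (simp add: less_imp_le)
  have PB: "prob (B n) \<le> \<delta> n / 2" for n
  proof -
    have le: "prob (E (n + m)) \<le> \<delta> n / 4 * (1 / 2) ^ m" for m
      using bad[of "n + m"] decay[of n m] by (simp add: E_def)
    have summ: "summable (\<lambda>m. prob (E (n + m)))"
      by (rule summable_comparison_test'[OF sums_summable[OF geo[of n]], of 0]) (use le in auto)
    have "prob (B n) \<le> (\<Sum>m. prob (E (n + m)))"
      unfolding B_def using summ by (intro finite_measure_subadditive_countably) auto
    also have "\<dots> \<le> (\<Sum>m. \<delta> n / 4 * (1 / 2) ^ m)"
      using summ le sums_summable[OF geo] by (intro suminf_le) auto
    also have "\<dots> = \<delta> n / 2" using sums_unique[OF geo] by simp
    finally show ?thesis .
  qed
  have close: "dist (g n \<omega>) (g (n + m) \<omega>) \<le> \<delta> n / 2" if "\<omega> \<in> space M - B n" for \<omega> n m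
  proof -
    have "dist (g n \<omega>) (g (n + m) \<omega>) \<le> (\<Sum>i<m. \<delta> n / 4 * (1 / 2) ^ i)"
    proof (induction m)
      case (Suc m)
      have "\<omega> \<notin> E (n + m)" using that by (auto simp: B_def)
      then have "dist (g (n + m) \<omega>) (g (n + Suc m) \<omega>) \<le> \<delta> (n + m) / 4"
        using that by (auto simp: E_def)
      then have "dist (g (n + m) \<omega>) (g (n + Suc m) \<omega>) \<le> \<delta> n / 4 * (1 / 2) ^ m"
        using decay[of n m] by simp
      then show ?case
        using Suc dist_triangle[of "g n \<omega>" "g (n + Suc m) \<omega>" "g (n + m) \<omega>"] by simp
    qed simp
    then show ?thesis using part[of n m] by linarith
  qed
  have B_mono: "B k \<subseteq> B n" if nk: "n \<le> k" for n k
  proof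
    fix \<omega> assume "\<omega> \<in> B k"
    then obtain m where "\<omega> \<in> E (k + m)" by (auto simp: B_def)
    moreover have "k + m = n + (k - n + m)" using nk by simp
    ultimately show "\<omega> \<in> B n" unfolding B_def by (metis UNIV_I UN_I)
  qed
  have Cauchy_good: "Cauchy (\<lambda>m. g m \<omega>)" if \<omega>: "\<omega> \<in> space M - B n" for \<omega> n
  proof (rule metric_CauchyI)
    fix e :: real assume e: "0 < e"
    have "(\<lambda>m. \<delta> n * (1 / 2) ^ m) \<longlonglongrightarrow> \<delta> n * 0"
      by (intro tendsto_mult tendsto_const LIMSEQ_realpow_zero) auto
    then have "\<forall>\<^sub>F m in sequentially. \<delta> n * (1 / 2) ^ m < e"
      using e by (intro order_tendstoD) auto
    then obtain m where "\<delta> n * (1 / 2) ^ m < e" by (auto simp: eventually_sequentially)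
    then have small: "\<delta> (n + m) < e" using decay[of n m] by linarith
    have "\<omega> \<in> space M - B (n + m)" using \<omega> B_mono[of n "n + m"] by auto
    then have near: "dist (g (n + m) \<omega>) (g a \<omega>) \<le> \<delta> (n + m) / 2" if "n + m \<le> a" for a
      using close[of \<omega> "n + m" "a - (n + m)"] that by simp
    show "\<exists>N. \<forall>a\<ge>N. \<forall>b\<ge>N. dist (g a \<omega>) (g b \<omega>) < e"
    proof (intro exI[of _ "n + m"] allI impI)
      fix a b assume "n + m \<le> a" "n + m \<le> b"
      then show "dist (g a \<omega>) (g b \<omega>) < e"
        using near[of a] near[of b] small dist_triangle3[of "g a \<omega>" "g b \<omega>" "g (n + m) \<omega>"] by linarith
    qed
  qed
  define G where "G = (\<Union>n. space M - B n)"
  have G [measurable]: "G \<in> events" unfolding G_def by measurable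
  \<comment> \<open>The sequence is made constant where it may diverge, so that it converges everywhere to a measurable limit.\<close>
  define k where "k m \<omega> = (if \<omega> \<in> G then g m \<omega> else undefined)" for m \<omega>
  define h where "h \<omega> = lim (\<lambda>m. k m \<omega>)" for \<omega>
  have lim: "(\<lambda>m. k m \<omega>) \<longlonglongrightarrow> h \<omega>" for \<omega>
  proof (cases "\<omega> \<in> G")
    case True
    then obtain n where "\<omega> \<in> space M - B n" by (auto simp: G_def)
    from Cauchy_convergent[OF Cauchy_good[OF this]] show ?thesis
      using True by (simp add: h_def k_def convergent_LIMSEQ_iff)
  next
    case False
    then show ?thesis by (simp add: h_def k_def)
  qed
  have k_meas: "k m \<in> borel_measurable M" for m
    unfolding k_def using g by measurable
  have h: "h \<in> borel_measurable M"
    by (rule borel_measurable_LIMSEQ_metric[OF k_meas lim])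
  show ?thesis
  proof (intro bexI[OF _ h] allI)
    fix n
    have "\<omega> \<in> B n" if \<omega>: "\<omega> \<in> space M" "\<delta> n \<le> dist (g n \<omega>) (h \<omega>)" for \<omega>
    proof (rule ccontr)
      assume "\<omega> \<notin> B n"
      then have good: "\<omega> \<in> space M - B n" using \<omega> by simp
      then have "\<omega> \<in> G" by (auto simp: G_def)
      then have "(\<lambda>m. g m \<omega>) \<longlonglongrightarrow> h \<omega>"
        using lim[of \<omega>] \<open>\<omega> \<in> G\<close> by (simp add: k_def)
      then have "(\<lambda>m. g (m + n) \<omega>) \<longlonglongrightarrow> h \<omega>" by (rule LIMSEQ_ignore_initial_segment)
      then have "(\<lambda>m. dist (g n \<omega>) (g (n + m) \<omega>)) \<longlonglongrightarrow> dist (g n \<omega>) (h \<omega>)"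
        by (intro tendsto_dist tendsto_const) (simp add: add.commute)
      then have "dist (g n \<omega>) (h \<omega>) \<le> \<delta> n / 2"
        using close[OF good] by (intro LIMSEQ_le_const2) auto
      then show False using \<omega>(2) \<delta>(1)[of n] by linarith
    qed
    then have "prob {\<omega> \<in> space M. \<delta> n \<le> dist (g n \<omega>) (h \<omega>)} \<le> prob (B n)"
      using B by (intro finite_measure_mono) auto
    then show "prob {\<omega> \<in> space M. \<delta> n \<le> dist (g n \<omega>) (h \<omega>)} \<le> \<delta> n"
      using PB[of n] \<delta>(1)[of n] by linarith
  qed
qed

section \<open>Dense open sets of measures and the Baire property\<close>

text \<open>
  Continuous functions between the indicators of a point and of a ball around it. They replace the
  semicontinuity of the mass of an open set: the conditions below on tent integrals are open, and
  bound ball masses from below.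
\<close>

definition tent :: "'a::metric_space \<Rightarrow> real \<Rightarrow> 'a \<Rightarrow> real" where
  "tent x r y = max 0 (1 - dist x y / r)"

lemma tent_continuous: "0 < r \<Longrightarrow> continuous_on UNIV (tent x r)"
  unfolding tent_def by (intro continuous_intros) auto

lemma tent_le_indicator: "0 < r \<Longrightarrow> tent x r y \<le> indicator (ball x r) y"
  by (auto simp: tent_def indicator_def)

lemma indicator_le_tent: "indicator {x} y \<le> tent x r y"
  by (auto simp: tent_def indicator_def)

lemma tent_bounded: "0 < r \<Longrightarrow> bounded (range (tent x r))"
  by (intro boundedI[of _ 1]) (auto simp: tent_def)

lemma tent_integral:
  fixes x :: "'a::polish_space"
  assumes "\<mu> \<in> prob_measures" "0 < r"
  shows "measure \<mu> {x} \<le> (\<integral>y. tent x r y \<partial>\<mu>)" "(\<integral>y. tent x r y \<partial>\<mu>) \<le> measure \<mu> (ball x r)"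
proof -
  interpret prob_space \<mu> using assms(1) by (simp add: prob_measures_def)
  have sets: "sets \<mu> = sets borel" using assms(1) by (simp add: prob_measures_def)
  have int: "integrable \<mu> (tent x r)"
    using assms by (intro integrable_bounded_continuous tent_continuous tent_bounded)
  have ind: "integrable \<mu> (indicator A :: 'a \<Rightarrow> real)" if "A \<in> sets borel" for A
    using that by (simp add: sets emeasure_eq_measure)
  have meas: "measure \<mu> A = (\<integral>y. indicator A y \<partial>\<mu>)" if "A \<in> sets borel" for A
    using that sets.sets_into_space[of A \<mu>] by (simp add: sets Int_absorb2)
  show "measure \<mu> {x} \<le> (\<integral>y. tent x r y \<partial>\<mu>)"
    unfolding meas[OF borel_singleton[OF sets.empty_sets]]
    by (intro integral_mono ind int indicator_le_tent) simp
  have "ball x r \<in> sets borel" by simp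
  then show "(\<integral>y. tent x r y \<partial>\<mu>) \<le> measure \<mu> (ball x r)"
    unfolding meas[OF \<open>ball x r \<in> sets borel\<close>]
    by (intro integral_mono ind int tent_le_indicator assms)
qed

lemma openin_tent_integral_gt:
  "0 < r \<Longrightarrow> openin prob_topology {\<mu> \<in> prob_measures. c < (\<integral>y. tent x r y \<partial>\<mu>)}"
  unfolding prob_topology_def
  by (rule topology_generated_by_Basis)
    (use tent_continuous[of r x] tent_bounded[of r x] in \<open>auto intro!: exI[of _ "tent x r"] exI[of _ "{c<..}"]\<close>)

lemma separating_radius:
  fixes S :: "'a::metric_space set"
  assumes "finite S" "0 < \<epsilon>"
  shows "\<exists>r>0. r \<le> \<epsilon> \<and> disjoint_family_on (\<lambda>x. ball x r) S"
proof -
  have "\<exists>d>0. \<forall>p\<in>S \<times> S. fst p \<noteq> snd p \<longrightarrow> 2 * d \<le> dist (fst p) (snd p)"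
  proof (rule common_radius)
    fix p :: "'a \<times> 'a"
    show "\<exists>d>0. fst p \<noteq> snd p \<longrightarrow> 2 * d \<le> dist (fst p) (snd p)"
      by (intro exI[of _ "if fst p = snd p then 1 else dist (fst p) (snd p) / 2"]) auto
  qed (use assms in auto)
  then obtain d where d: "0 < d" "\<And>x y. x \<in> S \<Longrightarrow> y \<in> S \<Longrightarrow> x \<noteq> y \<Longrightarrow> 2 * d \<le> dist x y"
    by (metis SigmaI fst_conv snd_conv)
  have "ball x (min d \<epsilon>) \<inter> ball y (min d \<epsilon>) = {}" if "x \<in> S" "y \<in> S" "x \<noteq> y" for x y
  proof (rule equals0I)
    fix z assume "z \<in> ball x (min d \<epsilon>) \<inter> ball y (min d \<epsilon>)"
    then have "dist x z < d" "dist y z < d" by auto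
    then have "dist x y < 2 * d" using dist_triangle2[of x y z] by linarith
    then show False using d(2)[OF that] by simp
  qed
  then show ?thesis
    using d(1) assms(2) by (intro exI[of _ "min d \<epsilon>"]) (auto simp: disjoint_family_on_def)
qed

text \<open>
  The coupling with a constant variable.
\<close>

lemma (in atomless_prob_space) realize_finite_support:
  fixes \<nu> :: "'x::polish_space measure"
  assumes \<nu>: "\<nu> \<in> prob_measures" "finite T" "emeasure \<nu> (- T) = 0"
  shows "\<exists>g\<in>borel_measurable M. (\<forall>\<omega>\<in>space M. g \<omega> \<in> T) \<and> distr M borel g = \<nu>"
proof -
  interpret \<nu>: prob_space \<nu> using \<nu> by (simp add: prob_measures_def)
  have sets_\<nu>: "sets \<nu> = sets borel" using \<nu>(1) by (simp add: prob_measures_def)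
  have space_\<nu>: "space \<nu> = UNIV" using sets_eq_imp_space_eq[OF sets_\<nu>] by simp
  have total: "(\<Sum>y\<in>T. measure \<nu> {y}) = 1"
    using measure_finite_support[OF \<nu>, of UNIV] \<nu>.prob_space by (simp add: space_\<nu>)
  have "\<exists>g\<in>borel_measurable M. (\<forall>\<omega>\<in>space M. g \<omega> \<in> T) \<and> distr M borel g = \<nu> \<and>
    (\<forall>x\<in>{undefined::'x}. \<forall>y\<in>T. prob {\<omega> \<in> space M. undefined = x \<and> g \<omega> = y} = measure \<nu> {y})"
    by (rule realize_finite_coupling[of "\<lambda>_. undefined" "{undefined}" \<nu> T "\<lambda>_ y. measure \<nu> {y}"])
      (use \<nu> total prob_space in auto)
  then show ?thesis by auto
qed

text \<open>
  A dense open set \<open>D\<close> of measures can be entered by changing \<open>g\<close> only slightly in probability.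
  Measures near the law of \<open>g\<close> give each ball around an atom almost the mass of that atom. Pick
  such a measure in \<open>D\<close>, finitely supported; a transport plan that is nearly diagonal moves the
  law of \<open>g\<close> to it.
\<close>

lemma (in atomless_prob_space) perturb_into_dense_open:
  fixes g :: "'a \<Rightarrow> 'x::polish_space"
  assumes D: "openin prob_topology D" "\<And>W. openin prob_topology W \<Longrightarrow> W \<noteq> {} \<Longrightarrow> W \<inter> D \<noteq> {}"
    and g: "g \<in> borel_measurable M" "finite S" "\<And>\<omega>. \<omega> \<in> space M \<Longrightarrow> g \<omega> \<in> S"
    and \<epsilon>: "0 < \<epsilon>" "\<epsilon> < 1"
  shows "\<exists>g'\<in>borel_measurable M. finite (g' ` space M) \<and> distr M borel g' \<in> D \<and>
    prob {\<omega> \<in> space M. \<epsilon> \<le> dist (g \<omega>) (g' \<omega>)} \<le> \<epsilon>"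
proof -
  define w where "w x = prob {\<omega> \<in> space M. g \<omega> = x}" for x
  have w_sum: "sum w S = 1"
  proof -
    have "sum w S = prob (\<Union>x\<in>S. {\<omega> \<in> space M. g \<omega> = x})"
      unfolding w_def using g(1,2)
      by (intro finite_measure_finite_Union[symmetric]) (auto simp: disjoint_family_on_def)
    also have "(\<Union>x\<in>S. {\<omega> \<in> space M. g \<omega> = x}) = space M" using g(3) by auto
    finally show ?thesis by (simp add: prob_space)
  qed
  obtain r where r: "0 < r" "r \<le> \<epsilon>" "disjoint_family_on (\<lambda>x. ball x r) S"
    using separating_radius[OF g(2) \<epsilon>(1)] by auto
  \<comment> \<open>Only atoms of positive weight give a condition that the law of \<open>g\<close> satisfies strictly.\<close>
  define N where "N x = {\<mu> \<in> prob_measures. (1 - \<epsilon>) * w x < (\<integral>y. tent x r y \<partial>\<mu>)}" for x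
  define W where "W = (\<Inter>x\<in>{x\<in>S. 0 < w x}. N x) \<inter> topspace prob_topology"
  have W_open: "openin prob_topology W"
    unfolding W_def N_def using g(2) r(1) by (intro openin_INT openin_tent_integral_gt) auto
  have law: "distr M borel g \<in> prob_measures"
    by (rule prob_measures_distr[OF prob_space_axioms g(1)])
  have "distr M borel g \<in> W"
  proof -
    have "distr M borel g \<in> N x" if "0 < w x" for x
    proof -
      have "(1 - \<epsilon>) * w x < w x" using that \<epsilon> by simp
      also have "w x = measure (distr M borel g) {x}"
        unfolding w_def using g(1) by (subst measure_distr) (auto intro!: arg_cong[where f = prob])
      also have "\<dots> \<le> (\<integral>y. tent x r y \<partial>distr M borel g)" by (rule tent_integral(1)[OF law r(1)])
      finally show ?thesis using law by (simp add: N_def)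
    qed
    then show ?thesis using law by (auto simp: W_def topspace_prob_topology)
  qed
  then have "W \<inter> D \<noteq> {}" using D(2)[OF W_open] by auto
  moreover have "openin prob_topology (W \<inter> D)" using W_open D(1) by (rule openin_Int)
  ultimately obtain \<nu> T where \<nu>WD: "\<nu> \<in> W \<inter> D" and \<nu>: "\<nu> \<in> prob_measures" "finite T" "emeasure \<nu> (- T) = 0"
    using prob_topology_finite_support_dense[of "W \<inter> D"] by metis
  interpret \<nu>: prob_space \<nu> using \<nu> by (simp add: prob_measures_def)
  have sets_\<nu>: "sets \<nu> = sets borel" using \<nu>(1) by (simp add: prob_measures_def)
  have space_\<nu>: "space \<nu> = UNIV" using sets_eq_imp_space_eq[OF sets_\<nu>] by simp
  define v where "v y = measure \<nu> {y}" for y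
  have v_sum: "sum v T = 1"
    using measure_finite_support[OF \<nu>, of UNIV] \<nu>.prob_space by (simp add: space_\<nu> v_def)
  have heavy: "(1 - \<epsilon>) * w x \<le> sum v (T \<inter> ball x r)" if "x \<in> S" for x
  proof (cases "0 < w x")
    case True
    then have "\<nu> \<in> N x" using \<nu>WD that by (auto simp: W_def)
    then have "(1 - \<epsilon>) * w x \<le> (\<integral>y. tent x r y \<partial>\<nu>)" by (simp add: N_def)
    also have "\<dots> \<le> measure \<nu> (ball x r)" by (rule tent_integral(2)[OF \<nu>(1) r(1)])
    also have "\<dots> = sum v (T \<inter> ball x r)"
      unfolding v_def by (rule measure_finite_support[OF \<nu>]) simp
    finally show ?thesis .
  next
    case False
    then have "w x = 0" using measure_nonneg[of M] by (simp add: w_def not_less order_antisym)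
    then show ?thesis by (simp add: v_def sum_nonneg)
  qed
  have "\<exists>\<pi>. (\<forall>x\<in>S. \<forall>y\<in>T. 0 \<le> \<pi> x y) \<and> (\<forall>x\<in>S. (\<Sum>y\<in>T. \<pi> x y) = w x) \<and>
    (\<forall>y\<in>T. (\<Sum>x\<in>S. \<pi> x y) = v y) \<and> (\<Sum>x\<in>S. \<Sum>y\<in>T - ball x r. \<pi> x y) \<le> \<epsilon>"
    by (rule near_diagonal_transport_plan[OF g(2) \<nu>(2) _ w_sum _ v_sum \<epsilon> r(3) heavy])
      (simp_all add: w_def v_def)
  then obtain \<pi> where \<pi>: "\<forall>x\<in>S. \<forall>y\<in>T. 0 \<le> \<pi> x y" "\<forall>x\<in>S. (\<Sum>y\<in>T. \<pi> x y) = w x"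
    "\<forall>y\<in>T. (\<Sum>x\<in>S. \<pi> x y) = v y" "(\<Sum>x\<in>S. \<Sum>y\<in>T - ball x r. \<pi> x y) \<le> \<epsilon>"
    by (elim exE conjE)
  have "\<exists>g'\<in>borel_measurable M. (\<forall>\<omega>\<in>space M. g' \<omega> \<in> T) \<and> distr M borel g' = \<nu> \<and>
    (\<forall>x\<in>S. \<forall>y\<in>T. prob {\<omega> \<in> space M. g \<omega> = x \<and> g' \<omega> = y} = \<pi> x y)"
    by (rule realize_finite_coupling[OF g \<nu>]) (use \<pi> in \<open>simp_all add: w_def v_def\<close>)
  then obtain g' where g': "g' \<in> borel_measurable M" "\<forall>\<omega>\<in>space M. g' \<omega> \<in> T" "distr M borel g' = \<nu>"
    and joint: "\<forall>x\<in>S. \<forall>y\<in>T. prob {\<omega> \<in> space M. g \<omega> = x \<and> g' \<omega> = y} = \<pi> x y"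
    by (elim bexE conjE)
  have pair_sets: "{\<omega> \<in> space M. g \<omega> = x \<and> g' \<omega> = y} \<in> events" for x y
    using g(1) g'(1) by measurable
  define P where "P = (SIGMA x:S. T - ball x r)"
  have P_fin: "finite P" using g(2) \<nu>(2) by (auto simp: P_def)
  have "prob {\<omega> \<in> space M. \<epsilon> \<le> dist (g \<omega>) (g' \<omega>)}
      \<le> prob (\<Union>p\<in>P. {\<omega> \<in> space M. g \<omega> = fst p \<and> g' \<omega> = snd p})"
    using g(3) g'(2) r(2) pair_sets P_fin
    by (intro finite_measure_mono) (auto simp: P_def)
  also have "\<dots> \<le> (\<Sum>p\<in>P. prob {\<omega> \<in> space M. g \<omega> = fst p \<and> g' \<omega> = snd p})"
    using P_fin pair_sets by (intro measure_UNION_le) auto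
  also have "\<dots> = (\<Sum>p\<in>P. \<pi> (fst p) (snd p))"
    using joint by (intro sum.cong) (auto simp: P_def)
  also have "\<dots> = (\<Sum>x\<in>S. \<Sum>y\<in>T - ball x r. \<pi> x y)"
    unfolding P_def using g(2) \<nu>(2) by (subst sum.Sigma) (auto simp: case_prod_unfold)
  also have "\<dots> \<le> \<epsilon>" by (rule \<pi>(4))
  finally have "prob {\<omega> \<in> space M. \<epsilon> \<le> dist (g \<omega>) (g' \<omega>)} \<le> \<epsilon>" .
  moreover have "finite (g' ` space M)"
    by (rule finite_subset[OF _ \<nu>(2)]) (use g'(2) in auto)
  ultimately show ?thesis
    using g' \<nu>WD by (intro bexI[of _ g']) auto
qed

definition dense_openin :: "'a topology \<Rightarrow> 'a set \<Rightarrow> bool" where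
  "dense_openin T D \<longleftrightarrow> openin T D \<and> (\<forall>W. openin T W \<longrightarrow> W \<noteq> {} \<longrightarrow> W \<inter> D \<noteq> {})"

text \<open>
  The usual proof of the Baire category theorem, carried out on random variables instead of
  measures. A stage is a pair \<open>(g, \<delta>)\<close> where \<open>g\<close> has finitely many values and every
  variable within \<open>\<delta>\<close> of \<open>g\<close> in probability has its law in the current open set; it plays the
  part of a closed ball inside that set. Each stage contains one for the next open set, and
  the variables \<open>g\<close> converge in probability to a variable that lies in all of them.
\<close>

lemma prob_topology_Baire:
  fixes D :: "nat \<Rightarrow> 'x::polish_space measure set"
  assumes D: "\<And>n. dense_openin prob_topology (D n)"
    and W: "openin prob_topology W" "W \<noteq> {}"
  shows "W \<inter> (\<Inter>n. D n) \<noteq> {}"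
proof -
  define M where "M = uniform_measure lborel {0..1::real}"
  interpret atomless_prob_space M
    unfolding M_def by (rule atomless_uniform)
  \<comment> \<open>The open sets to be met in turn.\<close>
  define R where "R n = (case n of 0 \<Rightarrow> W | Suc m \<Rightarrow> D m)" for n
  have R_open: "openin prob_topology (R n)" for n
    using W(1) D by (auto simp: R_def dense_openin_def split: nat.split)
  define stays where "stays n g \<delta> \<longleftrightarrow> (\<forall>h\<in>borel_measurable M.
      prob {\<omega> \<in> space M. \<delta> \<le> dist (g \<omega>) (h \<omega>)} \<le> \<delta> \<longrightarrow> distr M borel h \<in> R n)"
    for n and g :: "real \<Rightarrow> 'x" and \<delta>
  define ok where "ok n s \<longleftrightarrow> fst s \<in> borel_measurable M \<and> finite (fst s ` space M) \<and>
      0 < snd s \<and> snd s \<le> 1 \<and> stays n (fst s) (snd s)"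
    for n and s :: "(real \<Rightarrow> 'x) \<times> real"
  \<comment> \<open>The step and radius conditions under which the limit in probability stays within every radius.\<close>
  define follows where "follows s t \<longleftrightarrow> snd t \<le> snd s / 2 \<and>
      prob {\<omega> \<in> space M. snd s / 4 \<le> dist (fst s \<omega>) (fst t \<omega>)} \<le> snd s / 4"
    for s t :: "(real \<Rightarrow> 'x) \<times> real"
  have radius: "\<exists>\<delta>>0. \<delta> \<le> c \<and> stays n g \<delta>"
    if g: "g \<in> borel_measurable M" "finite (g ` space M)" "distr M borel g \<in> R n" and c: "0 < c"
    for n g and c :: real
  proof -
    obtain \<delta> where \<delta>: "0 < \<delta>" "stays n g \<delta>"
      using law_stable[OF R_open g(3) g(1,2)] unfolding stays_def by blast
    have "stays n g (min \<delta> c)"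
      using \<delta>(2) far_prob_mono[OF g(1), where d' = "min \<delta> c" and d = \<delta>] unfolding stays_def by auto
    then show ?thesis using \<delta>(1) c by (intro exI[of _ "min \<delta> c"]) auto
  qed
  have "\<exists>f. \<forall>n. ok n (f n) \<and> follows (f n) (f (Suc n))"
  proof (rule dependent_nat_choice)
    obtain \<nu> T where \<nu>: "\<nu> \<in> W" "\<nu> \<in> prob_measures" "finite T" "emeasure \<nu> (- T) = 0"
      using prob_topology_finite_support_dense[OF W] by metis
    obtain g where g: "g \<in> borel_measurable M" "\<forall>\<omega>\<in>space M. g \<omega> \<in> T" "distr M borel g = \<nu>"
      using realize_finite_support[OF \<nu>(2-4)] by auto
    have "finite (g ` space M)"
      by (rule finite_subset[OF _ \<nu>(3)]) (use g(2) in auto)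
    then show "\<exists>s. ok 0 s"
      using radius[of g 0 1] g \<nu>(1) by (auto simp: ok_def R_def)
  next
    fix s n assume s: "ok n s"
    obtain g' where g': "g' \<in> borel_measurable M" "finite (g' ` space M)" "distr M borel g' \<in> D n"
      "prob {\<omega> \<in> space M. snd s / 4 \<le> dist (fst s \<omega>) (g' \<omega>)} \<le> snd s / 4"
      using perturb_into_dense_open[of "D n" "fst s" "fst s ` space M" "snd s / 4"] D[of n] s
      by (auto simp: ok_def dense_openin_def)
    have "distr M borel g' \<in> R (Suc n)" using g'(3) by (simp add: R_def)
    then obtain \<delta> where "0 < \<delta>" "\<delta> \<le> snd s / 2" "stays (Suc n) g' \<delta>"
      using radius[OF g'(1,2), of "Suc n" "snd s / 2"] s by (auto simp: ok_def)
    then show "\<exists>t. ok (Suc n) t \<and> follows s t"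
      using g' s by (intro exI[of _ "(g', \<delta>)"]) (auto simp: ok_def follows_def)
  qed
  then obtain f where f: "\<And>n. ok n (f n)" "\<And>n. follows (f n) (f (Suc n))" by auto
  have "\<exists>h\<in>borel_measurable M. \<forall>n. prob {\<omega> \<in> space M. snd (f n) \<le> dist (fst (f n) \<omega>) (h \<omega>)} \<le> snd (f n)"
    by (rule limit_in_probability) (use f in \<open>auto simp: ok_def follows_def\<close>)
  then obtain h where h: "h \<in> borel_measurable M"
    "\<forall>n. prob {\<omega> \<in> space M. snd (f n) \<le> dist (fst (f n) \<omega>) (h \<omega>)} \<le> snd (f n)"
    by (elim bexE)
  have "distr M borel h \<in> R n" for n
    using f(1)[of n] h by (auto simp: ok_def stays_def)
  from this[of 0] this[of "Suc n" for n] show ?thesis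
    by (auto simp: R_def)
qed

section \<open>Generically null sets\<close>

text \<open>
  The infimum defining the outer measure is attained by a measurable set.
\<close>

lemma null_measures_iff:
  "\<mu> \<in> null_measures A \<longleftrightarrow> \<mu> \<in> prob_measures \<and> (\<exists>N\<in>null_sets \<mu>. A \<subseteq> N)"
proof -
  have "(outer_measure_of \<mu> A = 0) \<longleftrightarrow> (\<exists>N\<in>null_sets \<mu>. A \<subseteq> N)" if "\<mu> \<in> prob_measures"
  proof
    have "sets \<mu> = sets borel" using that by (simp add: prob_measures_def)
    then have "A \<subseteq> space \<mu>" using sets_eq_imp_space_eq[of \<mu> borel] by simp
    from outer_measure_of_attain[OF this]
    obtain E where E: "E \<in> sets \<mu>" "A \<subseteq> E" "outer_measure_of \<mu> A = emeasure \<mu> E"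
      by (elim bexE conjE)
    assume "outer_measure_of \<mu> A = 0"
    then have "E \<in> null_sets \<mu>" using E(1,3) by (intro null_setsI) simp_all
    then show "\<exists>N\<in>null_sets \<mu>. A \<subseteq> N" using E(2) by (rule bexI[rotated])
  next
    assume "\<exists>N\<in>null_sets \<mu>. A \<subseteq> N"
    then obtain N where "N \<in> null_sets \<mu>" "A \<subseteq> N" by (elim bexE)
    then have "N \<in> sets \<mu>" "emeasure \<mu> N = 0" "A \<subseteq> N" by (simp_all add: null_setsD1 null_setsD2)
    then show "outer_measure_of \<mu> A = 0"
      using outer_measure_of_mono[of A N \<mu>] by simp
  qed
  then show ?thesis by (auto simp: null_measures_def)
qed

text \<open>
  Nullity for all measures in a dense \<open>G\<^sub>\<delta>\<close> set. It follows from residual nullity, and unlike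
  the latter, which is phrased through nowhere dense sets, it is immediate to combine countably
  often and to transport along homeomorphisms.
\<close>

definition generically_null :: "'a::polish_space set \<Rightarrow> bool" where
  "generically_null A \<longleftrightarrow>
    (\<exists>D :: nat \<Rightarrow> _. (\<forall>n. dense_openin prob_topology (D n)) \<and> (\<Inter>n. D n) \<subseteq> null_measures A)"

lemma generically_null_if_residually_null:
  assumes "residually_null A"
  shows "generically_null A"
proof -
  obtain N :: "nat \<Rightarrow> _" where N: "\<And>n. nowhere_dense_in prob_topology (N n)"
    and cover: "topspace prob_topology - null_measures A = (\<Union>n. N n)"
    using assms by (auto simp: residually_null_def comeager_in_def meager_in_def)
  define D where "D n = topspace prob_topology - prob_topology closure_of N n" for n
  have "dense_openin prob_topology (D n)" for n
    unfolding dense_openin_def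
  proof (intro conjI allI impI notI)
    show "openin prob_topology (D n)" unfolding D_def by auto
    fix W :: "'a measure set"
    assume W: "openin prob_topology W" "W \<noteq> {}" and "W \<inter> D n = {}"
    then have "W \<subseteq> prob_topology closure_of N n"
      using openin_subset[OF W(1)] by (auto simp: D_def)
    then have "W \<subseteq> prob_topology interior_of (prob_topology closure_of N n)"
      using W(1) by (rule interior_of_maximal)
    then show False using N[of n] W(2) by (auto simp: nowhere_dense_in_def)
  qed
  moreover have "(\<Inter>n. D n) \<subseteq> null_measures A"
  proof
    fix \<mu> assume \<mu>: "\<mu> \<in> (\<Inter>n. D n)"
    have "N n \<subseteq> prob_topology closure_of N n" for n
      using N[of n] by (intro closure_of_subset) (simp add: nowhere_dense_in_def)
    then have "\<mu> \<notin> (\<Union>n. N n)" using \<mu> by (auto simp: D_def)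
    moreover have "\<mu> \<in> topspace prob_topology" using \<mu> by (auto simp: D_def)
    ultimately show "\<mu> \<in> null_measures A" using cover by blast
  qed
  ultimately show ?thesis unfolding generically_null_def by blast
qed

lemma generically_null_subset:
  assumes "generically_null A" "B \<subseteq> A"
  shows "generically_null B"
proof -
  have "null_measures A \<subseteq> null_measures B"
    using assms(2) unfolding subset_iff null_measures_iff by blast
  then show ?thesis using assms(1) unfolding generically_null_def by (meson subset_trans)
qed

lemma generically_null_UN:
  assumes "\<And>k :: nat. generically_null (A k)"
  shows "generically_null (\<Union>k. A k)"
proof -
  have "\<exists>D. \<forall>k. (\<forall>n :: nat. dense_openin prob_topology (D k n)) \<and> (\<Inter>n. D k n) \<subseteq> null_measures (A k)"
    using assms unfolding generically_null_def by (intro choice) auto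
  then obtain D where D: "\<And>k n :: nat. dense_openin prob_topology (D k n)"
    "\<And>k. (\<Inter>n. D k n) \<subseteq> null_measures (A k)"
    by blast
  have "(\<Inter>m. case_prod D (prod_decode m)) \<subseteq> null_measures (\<Union>k. A k)"
  proof
    fix \<mu> assume \<mu>: "\<mu> \<in> (\<Inter>m. case_prod D (prod_decode m))"
    have "\<mu> \<in> D k n" for k n
      using INT_D[OF \<mu>, of "prod_encode (k, n)"] by simp
    then have null: "\<mu> \<in> null_measures (A k)" for k using D(2)[of k] by blast
    then have "\<forall>k. \<exists>N. N \<in> null_sets \<mu> \<and> A k \<subseteq> N" unfolding null_measures_iff by blast
    from choice[OF this] obtain N where N: "\<And>k. N k \<in> null_sets \<mu>" "\<And>k. A k \<subseteq> N k" by auto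
    have "(\<Union>k. N k) \<in> null_sets \<mu>" using N(1) by (intro null_sets_UN) auto
    moreover have "(\<Union>k. A k) \<subseteq> (\<Union>k. N k)" using N(2) by blast
    ultimately show "\<mu> \<in> null_measures (\<Union>k. A k)"
      using null[of 0] unfolding null_measures_iff by blast
  qed
  then show ?thesis
    unfolding generically_null_def
    by (intro exI[of _ "\<lambda>m. case_prod D (prod_decode m)"]) (auto simp: D(1) split: prod.split)
qed

text \<open>
  Integrating \<open>f\<close> against the image measure is integrating the bounded continuous function
  \<open>f \<circ> \<tau>\<close>.
\<close>

lemma openin_distr_vimage:
  fixes \<tau> :: "'a::polish_space \<Rightarrow> 'b::polish_space"
  assumes \<tau>: "continuous_on UNIV \<tau>" and W: "openin prob_topology W"
  shows "openin prob_topology {\<mu> \<in> prob_measures. distr \<mu> borel \<tau> \<in> W}"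
proof -
  note meas = prob_measures_borel_measurable[OF _ \<tau>]
  note distr = prob_measures_distr_continuous[OF _ \<tau>]
  have "continuous_map prob_topology prob_topology (\<lambda>\<mu>. distr \<mu> borel \<tau>)"
    unfolding prob_topology_def[where 'a = 'b]
  proof (rule continuous_on_generated_topo)
    fix U :: "'b measure set"
    assume "U \<in> {{\<mu> \<in> prob_measures. (\<integral>x. f x \<partial>\<mu>) \<in> V} | f V.
        continuous_on UNIV f \<and> bounded (range f) \<and> open (V :: real set)}"
    then obtain f V where f: "continuous_on UNIV f" "bounded (range f)" "open (V :: real set)"
      and U: "U = {\<mu> \<in> prob_measures. (\<integral>x. f x \<partial>\<mu>) \<in> V}" by blast
    have "(\<lambda>\<mu>. distr \<mu> borel \<tau>) -` U \<inter> topspace prob_topology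
        = {\<mu> \<in> prob_measures. (\<integral>x. f (\<tau> x) \<partial>\<mu>) \<in> V}"
      using meas distr borel_measurable_continuous_onI[OF f(1)]
      by (auto simp: U topspace_prob_topology integral_distr)
    moreover have "continuous_on UNIV (\<lambda>x. f (\<tau> x))"
      using continuous_on_compose2[OF f(1) \<tau>] by simp
    moreover have "bounded (range (\<lambda>x. f (\<tau> x)))"
      using f(2) by (rule bounded_subset) auto
    ultimately show "openin prob_topology ((\<lambda>\<mu>. distr \<mu> borel \<tau>) -` U \<inter> topspace prob_topology)"
      unfolding prob_topology_def using f(3)
      by (auto intro!: topology_generated_by_Basis)
  next
    show "(\<lambda>\<mu>. distr \<mu> borel \<tau>) ` topspace prob_topology \<subseteq> \<Union> {{\<mu> \<in> prob_measures. (\<integral>x. f x \<partial>\<mu>) \<in> V} | f V.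
        continuous_on UNIV f \<and> bounded (range f) \<and> open (V :: real set)}"
      using distr topspace_prob_topology[where 'a = 'b]
      unfolding topspace_prob_topology[where 'a = 'a] prob_topology_def topology_generated_by_topspace by auto
  qed
  then show ?thesis
    using W by (simp add: continuous_map_def topspace_prob_topology)
qed

text \<open>
  Taking image measures along \<open>\<tau>\<close> and along its inverse \<open>\<sigma>\<close> are mutually inverse continuous
  maps on the space of measures, so preimages of dense open sets are dense and open.
\<close>

lemma generically_null_vimage_homeomorphism:
  fixes \<tau> \<sigma> :: "'a::polish_space \<Rightarrow> 'a"
  assumes A: "generically_null A"
    and \<tau>: "continuous_on UNIV \<tau>" "continuous_on UNIV \<sigma>"
    and inv: "\<And>x. \<sigma> (\<tau> x) = x" "\<And>x. \<tau> (\<sigma> x) = x"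
  shows "generically_null (\<tau> -` A)"
proof -
  obtain D :: "nat \<Rightarrow> _" where D: "\<And>n. dense_openin prob_topology (D n)" "(\<Inter>n. D n) \<subseteq> null_measures A"
    using A by (auto simp: generically_null_def)
  note meas = prob_measures_borel_measurable and distr = prob_measures_distr_continuous
  have round: "distr (distr \<mu> borel \<rho>) borel \<rho>' = \<mu>"
    if "\<mu> \<in> prob_measures" "continuous_on UNIV \<rho>" "continuous_on UNIV \<rho>'" "\<And>x. \<rho>' (\<rho> x) = x"
    for \<mu> :: "'a measure" and \<rho> \<rho>' :: "'a \<Rightarrow> 'a"
  proof -
    have "distr (distr \<mu> borel \<rho>) borel \<rho>' = distr \<mu> borel (\<rho>' \<circ> \<rho>)"
      using meas[OF that(1,2)] borel_measurable_continuous_onI[OF that(3)] by (intro distr_distr) auto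
    also have "\<rho>' \<circ> \<rho> = (\<lambda>x. x)" using that(4) by auto
    also have "distr \<mu> borel (\<lambda>x. x) = \<mu>"
      using that(1) by (intro distr_id2) (simp add: prob_measures_def)
    finally show ?thesis .
  qed
  define D' where "D' n = {\<mu> \<in> prob_measures. distr \<mu> borel \<tau> \<in> D n}" for n
  have "dense_openin prob_topology (D' n)" for n
    unfolding dense_openin_def
  proof (intro conjI allI impI)
    show "openin prob_topology (D' n)"
      unfolding D'_def using D(1) by (intro openin_distr_vimage \<tau>) (simp add: dense_openin_def)
    fix W :: "'a measure set" assume W: "openin prob_topology W" "W \<noteq> {}"
    define W' where "W' = {\<mu> \<in> prob_measures. distr \<mu> borel \<sigma> \<in> W}"
    have W': "openin prob_topology W'" unfolding W'_def by (intro openin_distr_vimage \<tau> W)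
    obtain \<mu> where \<mu>: "\<mu> \<in> W" using W(2) by auto
    then have "\<mu> \<in> prob_measures" using openin_subset[OF W(1)] by (auto simp: topspace_prob_topology)
    then have "distr \<mu> borel \<tau> \<in> W'"
      using \<mu> by (simp add: W'_def distr \<tau> round inv)
    then obtain \<nu> where \<nu>: "\<nu> \<in> W'" "\<nu> \<in> D n"
      using D(1)[of n] W' unfolding dense_openin_def by blast
    then have "distr \<nu> borel \<sigma> \<in> W \<inter> D' n"
      by (simp add: W'_def D'_def distr \<tau> round inv)
    then show "W \<inter> D' n \<noteq> {}" by blast
  qed
  moreover have "(\<Inter>n. D' n) \<subseteq> null_measures (\<tau> -` A)"
  proof
    fix \<mu> assume \<mu>: "\<mu> \<in> (\<Inter>n. D' n)"
    then have \<mu>': "\<mu> \<in> prob_measures" "distr \<mu> borel \<tau> \<in> null_measures A"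
      using D(2) by (auto simp: D'_def)
    then obtain N where N: "N \<in> null_sets (distr \<mu> borel \<tau>)" "A \<subseteq> N"
      by (auto simp: null_measures_iff)
    have "sets \<mu> = sets borel" using \<mu>'(1) by (simp add: prob_measures_def)
    then have "space \<mu> = UNIV" using sets_eq_imp_space_eq[of \<mu> borel] by simp
    then have "\<tau> -` N \<in> null_sets \<mu>"
      using N(1) meas[OF \<mu>'(1) \<tau>(1)] by (simp add: null_sets_distr_iff)
    then show "\<mu> \<in> null_measures (\<tau> -` A)"
      using \<mu>'(1) N(2) unfolding null_measures_iff by (intro conjI bexI[of _ "\<tau> -` N"]) auto
  qed
  ultimately show ?thesis unfolding generically_null_def by blast
qed

text \<open>
  The measures with positive integral of a tent function inside \<open>U\<close> form a nonempty open set, as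
  it contains a point mass, and none of them makes \<open>U\<close> null. By the Baire property such a measure
  lies in any given dense \<open>G\<^sub>\<delta>\<close> set.
\<close>

lemma open_not_generically_null:
  fixes U :: "'a::polish_space set"
  assumes "open U" "U \<noteq> {}"
  shows "\<not> generically_null U"
proof
  assume "generically_null U"
  then obtain D :: "nat \<Rightarrow> _" where D: "\<And>n. dense_openin prob_topology (D n)" "(\<Inter>n. D n) \<subseteq> null_measures U"
    by (auto simp: generically_null_def)
  obtain x where x: "x \<in> U" using assms(2) by auto
  obtain r where r: "0 < r" "ball x r \<subseteq> U" using assms(1) x by (meson openE)
  define W :: "'a measure set" where "W = {\<mu> \<in> prob_measures. 0 < (\<integral>y. tent x r y \<partial>\<mu>)}"
  have W_open: "openin prob_topology W" unfolding W_def by (rule openin_tent_integral_gt[OF r(1)])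
  have "return borel x \<in> W"
  proof -
    have *: "return borel x \<in> prob_measures" by (simp add: prob_measures_def prob_space_return)
    have "measure (return borel x) {x} = 1" by (simp add: measure_return)
    then show ?thesis using tent_integral(1)[OF * r(1), of x] * by (simp add: W_def)
  qed
  then obtain \<mu> where \<mu>: "\<mu> \<in> W" "\<mu> \<in> null_measures U"
    using prob_topology_Baire[of D, OF D(1) W_open] D(2) by blast
  have prob: "\<mu> \<in> prob_measures" using \<mu>(1) by (simp add: W_def)
  obtain N where N: "N \<in> null_sets \<mu>" "U \<subseteq> N" using \<mu>(2) by (auto simp: null_measures_iff)
  have "ball x r \<in> sets \<mu>" using prob by (simp add: prob_measures_def)
  then have "ball x r \<in> null_sets \<mu>"
    by (rule null_sets_subset[OF N(1)]) (use N(2) r(2) in auto)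
  then have "measure \<mu> (ball x r) = 0" by (simp add: measure_eq_0_null_sets)
  then show False using tent_integral(2)[OF prob r(1), of x] \<mu>(1) by (simp add: W_def)
qed

section \<open>Automatic continuity\<close>

theorem theorem43:
  fixes \<phi> :: "'g::{topological_group_add, polish_space} \<Rightarrow> 'h::topological_group_add"
  assumes "separable_space (euclidean :: 'h topology)"
    and "\<And>x y. \<phi> (x + y) = \<phi> x + \<phi> y"
    and "EBP_measurable \<phi>"
  shows "continuous_on UNIV \<phi>"
proof -
  note hom = assms(2)
  obtain C :: "'h set" where C: "countable C" "closure C = UNIV"
    using assms(1) by (auto simp: separable_space_def)
  have C_meets: "C \<inter> W \<noteq> {}" if "open W" "W \<noteq> {}" for W
    using open_Int_closure_eq_empty[OF that(1), of C] C(2) that(2) by auto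
  have C_ne: "C \<noteq> {}" using C_meets[of UNIV] by auto
  have near_0: "\<exists>T. open T \<and> 0 \<in> T \<and> (\<forall>t\<in>T. \<phi> t \<in> W)" if W: "open W" "0 \<in> W" for W
  proof -
    obtain V where V: "open V" "0 \<in> V" "\<And>a b. a \<in> V \<Longrightarrow> b \<in> V \<Longrightarrow> - a + b \<in> W"
    proof -
      have "((\<lambda>p :: 'h \<times> 'h. - fst p + snd p) \<longlongrightarrow> - 0 + 0) (nhds 0 \<times>\<^sub>F nhds 0)"
        by (intro tendsto_add tendsto_minus filterlim_fst filterlim_snd)
      then have "\<forall>\<^sub>F p in nhds 0 \<times>\<^sub>F nhds 0. - fst p + snd p \<in> W"
        using W by (auto simp: tendsto_def)
      then obtain P Q where "\<forall>\<^sub>F a in nhds 0. P a" "\<forall>\<^sub>F b in nhds 0. Q b"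
        "\<And>a b. P a \<Longrightarrow> Q b \<Longrightarrow> - a + b \<in> W"
        by (auto simp: eventually_prod_filter)
      then have "\<forall>\<^sub>F a in nhds 0. P a \<and> Q a" by (intro eventually_conj)
      then obtain V where "open V" "0 \<in> V" "\<forall>a\<in>V. P a \<and> Q a" by (auto simp: eventually_nhds)
      then show ?thesis using that \<open>\<And>a b. P a \<Longrightarrow> Q b \<Longrightarrow> - a + b \<in> W\<close> by blast
    qed
    \<comment> \<open>The preimages of the translates of \<open>V\<close>; those by the countable dense set \<open>C\<close> cover the group.\<close>
    define A where "A c = \<phi> -` {y. - c + y \<in> V}" for c
    have "open {y. - c + y \<in> V}" for c
    proof -
      have "continuous_on UNIV (\<lambda>y. - c + y)" by (intro continuous_intros)
      from open_vimage[OF V(1) this] show ?thesis by (simp add: vimage_def)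
    qed
    then have "EBP_set (A c)" for c
      using assms(3) unfolding EBP_measurable_def A_def by blast
    then have "\<forall>c. \<exists>U. open U \<and> residually_null (sym_diff U (A c))"
      by (simp add: EBP_set_def)
    from choice[OF this] obtain U where U: "\<And>c. open (U c)" "\<And>c. generically_null (sym_diff (U c) (A c))"
      by (auto intro: generically_null_if_residually_null)
    \<comment> \<open>Otherwise the whole group would be a countable union of generically null sets.\<close>
    have "\<exists>c\<in>C. U c \<noteq> {}"
    proof (rule ccontr)
      assume "\<not> (\<exists>c\<in>C. U c \<noteq> {})"
      then have null: "generically_null (A c)" if "c \<in> C" for c
        using U(2)[of c] that by simp
      have "x \<in> (\<Union>k. A (from_nat_into C k))" for x
      proof -
        have "continuous_on UNIV (\<lambda>c. - c + \<phi> x)" by (intro continuous_intros)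
        from open_vimage[OF V(1) this] have "open {c. - c + \<phi> x \<in> V}" by (simp add: vimage_def)
        moreover have "\<phi> x \<in> {c. - c + \<phi> x \<in> V}" using V(2) by simp
        ultimately obtain c where c: "c \<in> C" "- c + \<phi> x \<in> V" using C_meets by blast
        then have "x \<in> A c" by (simp add: A_def)
        moreover obtain k where "from_nat_into C k = c"
          using from_nat_into_surj[OF C(1) c(1)] by auto
        ultimately show ?thesis by blast
      qed
      then have "(\<Union>k. A (from_nat_into C k)) = UNIV" by blast
      moreover have "generically_null (\<Union>k. A (from_nat_into C k))"
        by (intro generically_null_UN null from_nat_into C_ne)
      ultimately show False using open_not_generically_null[of "UNIV :: 'g set"] by simp
    qed
    then obtain c u where u: "u \<in> U c" by auto
    define N where "N = sym_diff (U c) (A c)"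
    have N: "generically_null N" unfolding N_def by (rule U(2))
    \<comment> \<open>For \<open>t\<close> in \<open>T\<close> the open sets \<open>U c\<close> and \<open>U c - t\<close> overlap, hence so do \<open>A c\<close> and \<open>A c - t\<close>, which differ from them by generically null sets.\<close>
    define T where "T = {t. u + t \<in> U c}"
    have "\<phi> t \<in> W" if t: "t \<in> T" for t
    proof -
      define U' where "U' = U c \<inter> (\<lambda>x. x + t) -` U c"
      have cont: "continuous_on UNIV (\<lambda>x. x + s)" for s :: 'g by (intro continuous_intros)
      have "open U'" unfolding U'_def by (intro open_Int U(1) open_vimage cont)
      moreover have "U' \<noteq> {}" using u t by (auto simp: U'_def T_def)
      ultimately have not_null: "\<not> generically_null U'" by (rule open_not_generically_null)
      have "generically_null ((\<lambda>x. x + t) -` N)"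
        by (rule generically_null_vimage_homeomorphism[OF N cont cont[of "- t"]])
          (simp_all add: add.assoc)
      \<comment> \<open>The union of two sets, written as a countable union.\<close>
      then have "generically_null (\<Union>k :: nat. if k = 0 then N else (\<lambda>x. x + t) -` N)"
        using N by (intro generically_null_UN) auto
      then have "\<not> U' \<subseteq> (\<Union>k :: nat. if k = 0 then N else (\<lambda>x. x + t) -` N)"
        using not_null generically_null_subset by blast
      then obtain x where "x \<in> U'" and x: "x \<notin> (\<Union>k :: nat. if k = 0 then N else (\<lambda>x. x + t) -` N)"
        by blast
      from x have "x \<notin> N" "x + t \<notin> N"
        by (auto split: if_splits dest: spec[of _ 0] spec[of _ 1])
      then have "x \<in> A c" "x + t \<in> A c" using \<open>x \<in> U'\<close> by (auto simp: U'_def N_def)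
      then have "- (- c + \<phi> x) + (- c + \<phi> (x + t)) \<in> W" by (intro V(3)) (auto simp: A_def)
      then show "\<phi> t \<in> W" by (simp add: hom minus_add add.assoc)
    qed
    moreover have "open T"
    proof -
      have "continuous_on UNIV (\<lambda>t. u + t)" by (intro continuous_intros)
      from open_vimage[OF U(1) this] show ?thesis by (simp add: T_def vimage_def)
    qed
    moreover have "0 \<in> T" using u by (simp add: T_def)
    ultimately show ?thesis by blast
  qed
  show ?thesis
    unfolding continuous_on_topological
  proof (intro ballI allI impI)
    fix x B assume B: "open B" "\<phi> x \<in> B"
    have "continuous_on UNIV (\<lambda>y. \<phi> x + y)" by (intro continuous_intros)
    from open_vimage[OF B(1) this] have "open {y. \<phi> x + y \<in> B}" by (simp add: vimage_def)
    then obtain T where T: "open T" "0 \<in> T" "\<forall>t\<in>T. \<phi> x + \<phi> t \<in> B"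
      using near_0[of "{y. \<phi> x + y \<in> B}"] B(2) by auto
    have "continuous_on UNIV (\<lambda>y. - x + y)" by (intro continuous_intros)
    from open_vimage[OF T(1) this] have "open {y. - x + y \<in> T}" by (simp add: vimage_def)
    moreover have "x \<in> {y. - x + y \<in> T}" using T(2) by simp
    moreover have "\<phi> y \<in> B" if "- x + y \<in> T" for y
      using T(3) that hom[of x "- x + y"] by (metis add.assoc right_minus add_0)
    ultimately show "\<exists>A. open A \<and> x \<in> A \<and> (\<forall>y\<in>UNIV. y \<in> A \<longrightarrow> \<phi> y \<in> B)" by blast
  qed
qed

end
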